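(* Let $(M,g,\tau,P)$ be a Carrollian--Poisson bundle with Carroll vector field $\kappa$. Then $P$ has a unique global decomposition $$P=\kappa\wedge E_{\mathsf H}+P_{\mathsf H},$$ where $E_{\mathsf H}\in\mathrm{Vect}_{\mathsf H}(M)$ and $P_{\mathsf H}\in\wedge^2\mathrm{Vect}_{\mathsf H}(M)$ is a horizontal bivector field, such that $P^\#(\tau)=E_{\mathsf H}$ and $P_{\mathsf H}^\#(\eta)=0$ for any $\eta\in\mathcal{A}_{\mathsf C}(M)$.
   Context: All manifolds are real, finite-dimensional, Hausdorff, second countable and smooth. $\mathrm{Vect}(M)$ denotes vector fields on $M$. A Carrollian bundle $(M,g,\tau)$ consists of a principal $\mathbb{R}$-bundle $\pi:M\to\Sigma$ (structure group $(\mathbb{R},+)$), with vertical bundle $\mathsf{V}M=\ker d\pi$ and vertical vector fields $\mathrm{Vect}_{\mathsf V}(M)$; a degenerate metric (symmetric 2-tensor) $g$ with $\ker(g)=\mathrm{Vect}_{\mathsf V}(M)$, not necessarily invariant under the action; and a clock form $\tau\in\Omega^1(M)$, i.e. an Ehresmann connection form (not necessarily principal nor flat), with horizontal vector fields $\mathrm{Vect}_{\mathsf H}(M)=\ker(\tau)$, so that $\mathrm{Vect}(M)=\mathrm{Vect}_{\mathsf V}(M)\oplus\mathrm{Vect}_{\mathsf H}(M)$. It is assumed that $g$ is positive on non-zero horizontal vectors. The Carroll vector field $\kappa$ is the fundamental vector field of the principal action, a nowhere vanishing frame of $\mathrm{Vect}_{\mathsf V}(M)$ normalised by $\tau(\kappa)=1$.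 Horizontal one-forms $\Omega^1_{\mathsf H}(M)$ are those annihilating vertical vector fields. A Poisson structure is a bivector field $P$ with vanishing Schouten--Nijenhuis bracket $[\![P,P]\!]=0$; its anchor is $P^\#:\Omega^1(M)\to\mathrm{Vect}(M)$, $P^\#(\alpha)=P(\alpha,-)$, so $\beta(P^\#(\alpha))=P(\alpha,\beta)$. Likewise $P_{\mathsf H}^\#(\alpha)=P_{\mathsf H}(\alpha,-)$. A Carrollian--Poisson bundle $(M,g,\tau,P)$ is a Carrollian bundle $(M,g,\tau)$ with a Poisson structure $P$ such that $\ker_m(g)\subset\mathrm{Im}(P^\#_m)$ at every point $m\in M$ where the rank of $P^\#_m:T^*_mM\to T_mM$ is non-zero. The module of Carrollian one-forms is $\mathcal{A}_{\mathsf C}(M)=\{\eta\in\Omega^1_{\mathsf H}(M)\mid P^\#(\eta)\in\ker(g)\}$. *)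

theory Defs
  imports "HOL-Analysis.Analysis"
begin

section \<open>Smooth manifolds\<close>

text \<open>
  The derivatives below are only used on open subsets of finite-dimensional spaces, where
  \<open>Ck_on k\<close> is the usual notion of a function of class \<open>C^k\<close>.
\<close>

primrec Ck_on :: "nat \<Rightarrow> 'a::real_normed_vector set \<Rightarrow> ('a \<Rightarrow> 'b::real_normed_vector) \<Rightarrow> bool" where
  "Ck_on 0 S f \<longleftrightarrow> continuous_on S f"
| "Ck_on (Suc k) S f \<longleftrightarrow>
     f differentiable_on S \<and> (\<forall>v. Ck_on k S (\<lambda>x. frechet_derivative f (at x) v))"

definition Cinf_on :: "'a::real_normed_vector set \<Rightarrow> ('a \<Rightarrow> 'b::real_normed_vector) \<Rightarrow> bool" where
  "Cinf_on S f \<longleftrightarrow> (\<forall>k. Ck_on k S f)"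

text \<open>
  A chart is a pair of its domain and its coordinate map. The atlas is not required to be maximal;
  none of the notions below changes when compatible charts are added.
\<close>

record ('m, 'e) mfd =
  mtop :: "'m topology"
  atlas :: "('m set \<times> ('m \<Rightarrow> 'e)) set"

abbreviation pts :: "('m, 'e, 'z) mfd_scheme \<Rightarrow> 'm set" where
  "pts M \<equiv> topspace (mtop M)"

text \<open>
  The model space is a finite-dimensional normed space rather than a type of class
  \<open>euclidean_space\<close>, because the latter excludes manifolds of dimension 0 (the base of a principal
  bundle may be discrete).
\<close>

locale smooth_manifold =
  fixes M :: "('m, 'e::real_normed_vector) mfd"
  assumes finite_dimensional: "\<exists>B::'e set. finite B \<and> span B = UNIV"
    and Hausdorff: "Hausdorff_space (mtop M)"
    and second_countable: "second_countable (mtop M)"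
    and charts_cover: "pts M = (\<Union>(U, \<phi>)\<in>atlas M. U)"
    and chart_open: "(U, \<phi>) \<in> atlas M \<Longrightarrow> openin (mtop M) U"
    and chart_image_open: "(U, \<phi>) \<in> atlas M \<Longrightarrow> open (\<phi> ` U)"
    and chart_homeomorphic: "(U, \<phi>) \<in> atlas M \<Longrightarrow>
      homeomorphic_map (subtopology (mtop M) U) (top_of_set (\<phi> ` U)) \<phi>"
    and charts_compatible: "(U, \<phi>) \<in> atlas M \<Longrightarrow> (V, \<psi>) \<in> atlas M \<Longrightarrow>
      Cinf_on (\<phi> ` (U \<inter> V)) (\<psi> \<circ> inv_into U \<phi>)"

text \<open>Smoothness of a map on an open subset \<open>W\<close> of \<open>M\<close>.\<close>

definition smooth_map_on ::
  "('m, 'e::real_normed_vector) mfd \<Rightarrow> ('n, 'f::real_normed_vector) mfd \<Rightarrow> 'm set \<Rightarrow> ('m \<Rightarrow> 'n) \<Rightarrow> bool"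
  where
  "smooth_map_on M N W F \<longleftrightarrow>
     continuous_map (subtopology (mtop M) W) (mtop N) F \<and>
     (\<forall>(U, \<phi>)\<in>atlas M. \<forall>(V, \<psi>)\<in>atlas N.
        Cinf_on (\<phi> ` {x \<in> U \<inter> W. F x \<in> V}) (\<psi> \<circ> F \<circ> inv_into U \<phi>))"

definition eucl :: "('e::real_normed_vector, 'e) mfd" where
  "eucl = \<lparr>mtop = euclidean, atlas = {(UNIV, id)}\<rparr>"

definition prod_mfd ::
  "('m, 'e::real_normed_vector) mfd \<Rightarrow> ('n, 'f::real_normed_vector) mfd \<Rightarrow> ('m \<times> 'n, 'e \<times> 'f) mfd" where
  "prod_mfd M N = \<lparr>mtop = prod_topology (mtop M) (mtop N),
     atlas = {(U \<times> V, map_prod \<phi> \<psi>) | U \<phi> V \<psi>. (U, \<phi>) \<in> atlas M \<and> (V, \<psi>) \<in> atlas N}\<rparr>"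

definition Cinf :: "('m, 'e::real_normed_vector) mfd \<Rightarrow> 'm set \<Rightarrow> ('m \<Rightarrow> real) set" where
  "Cinf M W = {f. smooth_map_on M eucl W f}"

definition smooth_near :: "('m, 'e::real_normed_vector) mfd \<Rightarrow> 'm \<Rightarrow> ('m \<Rightarrow> real) \<Rightarrow> bool" where
  "smooth_near M m f \<longleftrightarrow> (\<exists>W. openin (mtop M) W \<and> m \<in> W \<and> f \<in> Cinf M W)"


section \<open>Tangent and cotangent spaces\<close>

text \<open>
  A tangent vector at \<open>m\<close> is the velocity of a smooth curve through \<open>m\<close>, encoded by its action on the
  functions that are smooth near \<open>m\<close>. Since HOL functions are total, tangent vectors are set to
  zero on all other functions, and covectors are set to zero off the tangent space (similarly for
  tensors and fields below). Hence equality of HOL functions is equality of the geometric objects.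
\<close>

type_synonym 'm tvec = "('m \<Rightarrow> real) \<Rightarrow> real"
type_synonym 'm covec = "'m tvec \<Rightarrow> real"
type_synonym 'm bivec = "'m covec \<Rightarrow> 'm covec \<Rightarrow> real"

definition velocity :: "('m, 'e::real_normed_vector) mfd \<Rightarrow> (real \<Rightarrow> 'm) \<Rightarrow> 'm tvec" where
  "velocity M \<gamma> = (\<lambda>f. if smooth_near M (\<gamma> 0) f then deriv (f \<circ> \<gamma>) 0 else 0)"

definition tangent_space :: "('m, 'e::real_normed_vector) mfd \<Rightarrow> 'm \<Rightarrow> 'm tvec set" where
  "tangent_space M m =
     {velocity M \<gamma> | \<gamma>. \<gamma> 0 = m \<and> (\<exists>\<epsilon>>0. smooth_map_on eucl M {-\<epsilon><..<\<epsilon>} \<gamma>)}"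

definition cotangent_space :: "('m, 'e::real_normed_vector) mfd \<Rightarrow> 'm \<Rightarrow> 'm covec set" where
  "cotangent_space M m =
     {\<alpha>. (\<forall>v\<in>tangent_space M m. \<forall>w\<in>tangent_space M m. \<forall>a b.
            \<alpha> (\<lambda>f. a * v f + b * w f) = a * \<alpha> v + b * \<alpha> w) \<and>
         (\<forall>v. v \<notin> tangent_space M m \<longrightarrow> \<alpha> v = 0)}"

definition differential_at :: "('m, 'e::real_normed_vector) mfd \<Rightarrow> ('m \<Rightarrow> real) \<Rightarrow> 'm \<Rightarrow> 'm covec" where
  "differential_at M f m = (\<lambda>v. if v \<in> tangent_space M m then v f else 0)"

definition tangent_map ::
  "('m, 'e::real_normed_vector) mfd \<Rightarrow> ('n, 'f::real_normed_vector) mfd \<Rightarrow> ('m \<Rightarrow> 'n) \<Rightarrow> 'm \<Rightarrow>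
   'm tvec \<Rightarrow> 'n tvec" where
  "tangent_map M N F m v = (\<lambda>f. if smooth_near N (F m) f then v (f \<circ> F) else 0)"

text \<open>
  Bivectors at \<open>m\<close> are regarded as bilinear forms on the cotangent space, with the convention
  \<open>(v \<and> w)(\<alpha>, \<beta>) = \<alpha>(v) \<beta>(w) - \<alpha>(w) \<beta>(v)\<close>. For a linear subspace \<open>V\<close> of the tangent space,
  \<open>ext2 M m V\<close> is its second exterior power.
\<close>

definition wedge :: "('m, 'e::real_normed_vector) mfd \<Rightarrow> 'm \<Rightarrow> 'm tvec \<Rightarrow> 'm tvec \<Rightarrow> 'm bivec" where
  "wedge M m v w = (\<lambda>\<alpha> \<beta>.
     if \<alpha> \<in> cotangent_space M m \<and> \<beta> \<in> cotangent_space M m then \<alpha> v * \<beta> w - \<alpha> w * \<beta> v else 0)"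

definition ext2 :: "('m, 'e::real_normed_vector) mfd \<Rightarrow> 'm \<Rightarrow> 'm tvec set \<Rightarrow> 'm bivec set" where
  "ext2 M m V =
     {\<lambda>\<alpha> \<beta>. \<Sum>i<n. wedge M m (v i) (w i) \<alpha> \<beta> | (n::nat) v w. \<forall>i<n. v i \<in> V \<and> w i \<in> V}"


section \<open>Tensor fields\<close>

text \<open>
  \<open>Vect M W\<close> and \<open>Omega1 M W\<close> are the smooth vector fields and one-forms on an open set \<open>W\<close>.
  Smoothness is tested on locally defined functions, vector fields and one-forms, respectively.
\<close>

definition Vect :: "('m, 'e::real_normed_vector) mfd \<Rightarrow> 'm set \<Rightarrow> ('m \<Rightarrow> 'm tvec) set" where
  "Vect M W =
     {X. (\<forall>m\<in>W. X m \<in> tangent_space M m) \<and> (\<forall>m. m \<notin> W \<longrightarrow> X m = (\<lambda>f. 0)) \<and>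
         (\<forall>U. openin (mtop M) U \<and> U \<subseteq> W \<longrightarrow>
            (\<forall>f\<in>Cinf M U. (\<lambda>m. X m f) \<in> Cinf M U))}"

definition Omega1 :: "('m, 'e::real_normed_vector) mfd \<Rightarrow> 'm set \<Rightarrow> ('m \<Rightarrow> 'm covec) set" where
  "Omega1 M W =
     {\<alpha>. (\<forall>m\<in>W. \<alpha> m \<in> cotangent_space M m) \<and> (\<forall>m. m \<notin> W \<longrightarrow> \<alpha> m = (\<lambda>v. 0)) \<and>
         (\<forall>U. openin (mtop M) U \<and> U \<subseteq> W \<longrightarrow>
            (\<forall>X\<in>Vect M U. (\<lambda>m. \<alpha> m (X m)) \<in> Cinf M U))}"

definition sym2_tensors ::
  "('m, 'e::real_normed_vector) mfd \<Rightarrow> ('m \<Rightarrow> 'm tvec \<Rightarrow> 'm tvec \<Rightarrow> real) set" where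
  "sym2_tensors M =
     {g. (\<forall>m v. g m v \<in> cotangent_space M m) \<and> (\<forall>m v w. g m v w = g m w v) \<and>
         (\<forall>m. m \<notin> pts M \<longrightarrow> g m = (\<lambda>v w. 0)) \<and>
         (\<forall>U. openin (mtop M) U \<longrightarrow>
            (\<forall>X\<in>Vect M U. \<forall>Y\<in>Vect M U. (\<lambda>m. g m (X m) (Y m)) \<in> Cinf M U))}"

text \<open>
  For a family \<open>D\<close> of subspaces of the tangent spaces, these are the smooth bivector fields with
  values in the second exterior power of \<open>D\<close>.
\<close>

definition bivector_fields_in ::
  "('m, 'e::real_normed_vector) mfd \<Rightarrow> ('m \<Rightarrow> 'm tvec set) \<Rightarrow> ('m \<Rightarrow> 'm bivec) set" where
  "bivector_fields_in M D =
     {P. (\<forall>m\<in>pts M. P m \<in> ext2 M m (D m)) \<and> (\<forall>m. m \<notin> pts M \<longrightarrow> P m = (\<lambda>\<alpha> \<beta>. 0)) \<and>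
         (\<forall>U. openin (mtop M) U \<longrightarrow>
            (\<forall>\<alpha>\<in>Omega1 M U. \<forall>\<beta>\<in>Omega1 M U. (\<lambda>m. P m (\<alpha> m) (\<beta> m)) \<in> Cinf M U))}"

definition bivector_fields :: "('m, 'e::real_normed_vector) mfd \<Rightarrow> ('m \<Rightarrow> 'm bivec) set" where
  "bivector_fields M = bivector_fields_in M (tangent_space M)"

text \<open>The anchor: \<open>\<beta>(P#(\<alpha>)) = P(\<alpha>, \<beta>)\<close>, at a point and on one-forms.\<close>

definition sharp_at ::
  "('m, 'e::real_normed_vector) mfd \<Rightarrow> ('m \<Rightarrow> 'm bivec) \<Rightarrow> 'm \<Rightarrow> 'm covec \<Rightarrow> 'm tvec" where
  "sharp_at M P m \<alpha> =
     (THE v. v \<in> tangent_space M m \<and> (\<forall>\<beta>\<in>cotangent_space M m. \<beta> v = P m \<alpha> \<beta>))"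

definition sharp ::
  "('m, 'e::real_normed_vector) mfd \<Rightarrow> ('m \<Rightarrow> 'm bivec) \<Rightarrow> ('m \<Rightarrow> 'm covec) \<Rightarrow> 'm \<Rightarrow> 'm tvec" where
  "sharp M P \<alpha> = (\<lambda>m. if m \<in> pts M then sharp_at M P m (\<alpha> m) else (\<lambda>f. 0))"

text \<open>
  A bivector field acts on functions as the biderivation \<open>(f, h) \<mapsto> P(df, dh)\<close>. With multivector
  fields regarded as multiderivations, the Schouten--Nijenhuis bracket of two bivector fields is
  the triderivation obtained by inserting \<open>Q\<close> into \<open>P\<close> and \<open>P\<close> into \<open>Q\<close>, each summed with signs
  over the (2,1)-shuffles. It is given by its values on local functions.
\<close>

definition bivector_apply ::
  "('m, 'e::real_normed_vector) mfd \<Rightarrow> ('m \<Rightarrow> 'm bivec) \<Rightarrow> ('m \<Rightarrow> real) \<Rightarrow> ('m \<Rightarrow> real) \<Rightarrow> 'm \<Rightarrow> real"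
  where
  "bivector_apply M P f h = (\<lambda>m. P m (differential_at M f m) (differential_at M h m))"

definition schouten_bracket ::
  "('m, 'e::real_normed_vector) mfd \<Rightarrow> ('m \<Rightarrow> 'm bivec) \<Rightarrow> ('m \<Rightarrow> 'm bivec) \<Rightarrow>
   ('m \<Rightarrow> real) \<Rightarrow> ('m \<Rightarrow> real) \<Rightarrow> ('m \<Rightarrow> real) \<Rightarrow> 'm \<Rightarrow> real" where
  "schouten_bracket M P Q f1 f2 f3 = (\<lambda>m.
     bivector_apply M P (bivector_apply M Q f1 f2) f3 m
   - bivector_apply M P (bivector_apply M Q f1 f3) f2 m
   + bivector_apply M P (bivector_apply M Q f2 f3) f1 m
   + bivector_apply M Q (bivector_apply M P f1 f2) f3 m
   - bivector_apply M Q (bivector_apply M P f1 f3) f2 m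
   + bivector_apply M Q (bivector_apply M P f2 f3) f1 m)"

definition poisson_structure :: "('m, 'e::real_normed_vector) mfd \<Rightarrow> ('m \<Rightarrow> 'm bivec) \<Rightarrow> bool" where
  "poisson_structure M P \<longleftrightarrow> P \<in> bivector_fields M \<and>
     (\<forall>U. openin (mtop M) U \<longrightarrow>
        (\<forall>f1\<in>Cinf M U. \<forall>f2\<in>Cinf M U. \<forall>f3\<in>Cinf M U. \<forall>m\<in>U.
           schouten_bracket M P P f1 f2 f3 m = 0))"


section \<open>Carrollian bundles\<close>

locale principal_R_bundle =
  total: smooth_manifold M + base: smooth_manifold S
  for M :: "('m, 'e::real_normed_vector) mfd" and S :: "('s, 'f::real_normed_vector) mfd" +
  fixes \<pi> :: "'m \<Rightarrow> 's" and act :: "'m \<Rightarrow> real \<Rightarrow> 'm"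
  assumes projection_smooth: "smooth_map_on M S (pts M) \<pi>"
    and action_smooth: "smooth_map_on (prod_mfd M eucl) M (pts M \<times> UNIV) (\<lambda>(m, t). act m t)"
    and action_zero: "m \<in> pts M \<Longrightarrow> act m 0 = m"
    and action_add: "m \<in> pts M \<Longrightarrow> act (act m s) t = act m (s + t)"
    and locally_trivial: "x \<in> pts S \<Longrightarrow> \<exists>U \<Phi>. openin (mtop S) U \<and> x \<in> U \<and>
      bij_betw \<Phi> (U \<times> UNIV) {m \<in> pts M. \<pi> m \<in> U} \<and>
      smooth_map_on (prod_mfd S eucl) M (U \<times> UNIV) \<Phi> \<and>
      smooth_map_on M (prod_mfd S eucl) {m \<in> pts M. \<pi> m \<in> U} (inv_into (U \<times> UNIV) \<Phi>) \<and>
      (\<forall>y\<in>U. \<forall>s t. \<pi> (\<Phi> (y, s)) = y \<and> act (\<Phi> (y, s)) t = \<Phi> (y, s + t))"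

definition carroll_field ::
  "('m, 'e::real_normed_vector) mfd \<Rightarrow> ('m \<Rightarrow> real \<Rightarrow> 'm) \<Rightarrow> 'm \<Rightarrow> 'm tvec" where
  "carroll_field M act = (\<lambda>m. if m \<in> pts M then velocity M (act m) else (\<lambda>f. 0))"

definition vertical_space ::
  "('m, 'e::real_normed_vector) mfd \<Rightarrow> ('s, 'f::real_normed_vector) mfd \<Rightarrow> ('m \<Rightarrow> 's) \<Rightarrow> 'm \<Rightarrow> 'm tvec set"
  where
  "vertical_space M S \<pi> m = {v \<in> tangent_space M m. tangent_map M S \<pi> m v = (\<lambda>f. 0)}"

definition Vect_V ::
  "('m, 'e::real_normed_vector) mfd \<Rightarrow> ('s, 'f::real_normed_vector) mfd \<Rightarrow> ('m \<Rightarrow> 's) \<Rightarrow>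
   ('m \<Rightarrow> 'm tvec) set" where
  "Vect_V M S \<pi> = {X \<in> Vect M (pts M). \<forall>m\<in>pts M. X m \<in> vertical_space M S \<pi> m}"

definition horizontal_space ::
  "('m, 'e::real_normed_vector) mfd \<Rightarrow> ('m \<Rightarrow> 'm covec) \<Rightarrow> 'm \<Rightarrow> 'm tvec set" where
  "horizontal_space M \<tau> m = {v \<in> tangent_space M m. \<tau> m v = 0}"

definition Vect_H ::
  "('m, 'e::real_normed_vector) mfd \<Rightarrow> ('m \<Rightarrow> 'm covec) \<Rightarrow> ('m \<Rightarrow> 'm tvec) set" where
  "Vect_H M \<tau> = {X \<in> Vect M (pts M). \<forall>m\<in>pts M. X m \<in> horizontal_space M \<tau> m}"

definition bivector_fields_H ::
  "('m, 'e::real_normed_vector) mfd \<Rightarrow> ('m \<Rightarrow> 'm covec) \<Rightarrow> ('m \<Rightarrow> 'm bivec) set" where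
  "bivector_fields_H M \<tau> = bivector_fields_in M (horizontal_space M \<tau>)"

definition Omega1_H ::
  "('m, 'e::real_normed_vector) mfd \<Rightarrow> ('s, 'f::real_normed_vector) mfd \<Rightarrow> ('m \<Rightarrow> 's) \<Rightarrow>
   ('m \<Rightarrow> 'm covec) set" where
  "Omega1_H M S \<pi> = {\<eta> \<in> Omega1 M (pts M). \<forall>X\<in>Vect_V M S \<pi>. \<forall>m\<in>pts M. \<eta> m (X m) = 0}"

definition metric_kernel ::
  "('m, 'e::real_normed_vector) mfd \<Rightarrow> ('m \<Rightarrow> 'm tvec \<Rightarrow> 'm tvec \<Rightarrow> real) \<Rightarrow> ('m \<Rightarrow> 'm tvec) set" where
  "metric_kernel M g =
     {X \<in> Vect M (pts M). \<forall>Y\<in>Vect M (pts M). \<forall>m\<in>pts M. g m (X m) (Y m) = 0}"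

definition metric_kernel_at ::
  "('m, 'e::real_normed_vector) mfd \<Rightarrow> ('m \<Rightarrow> 'm tvec \<Rightarrow> 'm tvec \<Rightarrow> real) \<Rightarrow> 'm \<Rightarrow> 'm tvec set" where
  "metric_kernel_at M g m = {v \<in> tangent_space M m. \<forall>w\<in>tangent_space M m. g m v w = 0}"

locale carrollian_bundle = principal_R_bundle M S \<pi> act
  for M :: "('m, 'e::real_normed_vector) mfd" and S :: "('s, 'f::real_normed_vector) mfd"
    and \<pi> :: "'m \<Rightarrow> 's" and act :: "'m \<Rightarrow> real \<Rightarrow> 'm" +
  fixes g :: "'m \<Rightarrow> 'm tvec \<Rightarrow> 'm tvec \<Rightarrow> real" and \<tau> :: "'m \<Rightarrow> 'm covec"
  assumes metric: "g \<in> sym2_tensors M"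
    and kernel_metric: "metric_kernel M g = Vect_V M S \<pi>"
    and clock_form: "\<tau> \<in> Omega1 M (pts M)"
    and clock_normalised: "m \<in> pts M \<Longrightarrow> \<tau> m (carroll_field M act m) = 1"
    and metric_positive: "m \<in> pts M \<Longrightarrow> v \<in> horizontal_space M \<tau> m \<Longrightarrow> v \<noteq> (\<lambda>f. 0) \<Longrightarrow> g m v v > 0"

text \<open>The rank of the anchor at \<open>m\<close> is non-zero iff its image is not the zero space.\<close>

locale carrollian_poisson_bundle = carrollian_bundle M S \<pi> act g \<tau>
  for M :: "('m, 'e::real_normed_vector) mfd" and S :: "('s, 'f::real_normed_vector) mfd"
    and \<pi> :: "'m \<Rightarrow> 's" and act :: "'m \<Rightarrow> real \<Rightarrow> 'm"
    and g :: "'m \<Rightarrow> 'm tvec \<Rightarrow> 'm tvec \<Rightarrow> real" and \<tau> :: "'m \<Rightarrow> 'm covec" +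
  fixes P :: "'m \<Rightarrow> 'm bivec"
  assumes poisson: "poisson_structure M P"
    and kernel_in_image: "m \<in> pts M \<Longrightarrow> sharp_at M P m ` cotangent_space M m \<noteq> {\<lambda>f. 0} \<Longrightarrow>
      metric_kernel_at M g m \<subseteq> sharp_at M P m ` cotangent_space M m"

definition carrollian_one_forms ::
  "('m, 'e::real_normed_vector) mfd \<Rightarrow> ('s, 'f::real_normed_vector) mfd \<Rightarrow> ('m \<Rightarrow> 's) \<Rightarrow>
   ('m \<Rightarrow> 'm tvec \<Rightarrow> 'm tvec \<Rightarrow> real) \<Rightarrow> ('m \<Rightarrow> 'm bivec) \<Rightarrow> ('m \<Rightarrow> 'm covec) set" where
  "carrollian_one_forms M S \<pi> g P = {\<eta> \<in> Omega1_H M S \<pi>. sharp M P \<eta> \<in> metric_kernel M g}"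

end

theory Submission
  imports Defs
begin

text \<open>
  The decomposition is the splitting of a bivector induced by the splitting of the tangent bundle
  into the line spanned by \<open>\<kappa>\<close> and the kernel of \<open>\<tau>\<close>. Contracting \<open>P = \<kappa> \<and> E + P_H\<close> with \<open>\<tau>\<close> annihilates the
  horizontal part and leaves \<open>P#(\<tau>) = E\<close>, because \<open>\<tau>(\<kappa>) = 1\<close> and \<open>\<tau>(E) = 0\<close>. This proves uniqueness
  (\<open>decomposition_unique\<close>) and dictates the choice \<open>E = P#(\<tau>)\<close> and \<open>P_H = P - \<kappa> \<and> E\<close>. The vector \<open>E\<close> is
  horizontal since \<open>\<tau>(E) = P(\<tau>, \<tau>) = 0\<close>, and expanding \<open>P = \<Sum>i. v_i \<and> w_i\<close> along the splitting shows that \<open>P_H\<close> is a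
  sum of wedges of horizontal vectors (\<open>horizontal_part\<close>).

  For a Carrollian one-form \<open>\<eta>\<close>, the field \<open>P#(\<eta>)\<close> lies in the kernel of \<open>g\<close>. Positivity of \<open>g\<close> on horizontal
  vectors makes it a multiple of \<open>\<kappa>\<close> (\<open>metric_kernel_spanned\<close>), whose coefficient \<open>P(\<eta>, \<tau>) = -\<eta>(E)\<close> is exactly the
  contribution of \<open>\<kappa> \<and> E\<close>; so \<open>P_H#(\<eta>) = 0\<close> (\<open>P_H_annihilates\<close>).

  These computations need two facts about manifolds. First, velocities of curves must form a vector
  space which covectors separate, for otherwise the anchor would not be well defined
  (\<open>chart_vector_tangent\<close>, \<open>tangent_lincomb\<close>, \<open>covectors_separate\<close>). Secondly, the constructed fields must be
  smooth. For \<open>E\<close> this follows from \<open>E f = P(\<tau>, df)\<close>. For \<open>P_H\<close> it requires that \<open>\<kappa>\<close> is smooth, which holds since \<open>\<kappa> f\<close>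
  is a partial derivative of \<open>f\<close> composed with the action (\<open>carroll_field_smooth\<close>). That step rests on the
  chain rule for maps of class \<open>C^k\<close> (\<open>Ck_on_compose\<close>).
\<close>

section \<open>Functions of class \<open>C^k\<close>\<close>

lemma Ck_on_has_derivative:
  assumes "open S" "Ck_on (Suc k) S f" "x \<in> S"
  shows "(f has_derivative frechet_derivative f (at x)) (at x)"
  using assms by (auto simp: differentiable_on_eq_differentiable_at frechet_derivative_works)

text \<open>
  Only the values on \<open>S\<close> count because \<open>S\<close> is open, so that derivatives at its points are those of
  germs. Fields and one-forms below are total functions which are set to zero off their domain;
  this lemma lets such extensions be exchanged.
\<close>

lemma Ck_on_cong:
  assumes "open S" and "\<And>x. x \<in> S \<Longrightarrow> f x = g x" and "Ck_on k S f"
  shows "Ck_on k S g"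
  using assms(2,3)
proof (induction k arbitrary: f g)
  case 0
  then show ?case by (metis Ck_on.simps(1) continuous_on_cong)
next
  case (Suc k)
  have diff: "f differentiable at x" if "x \<in> S" for x
    using Suc.prems(2) that \<open>open S\<close> by (simp add: differentiable_on_eq_differentiable_at)
  have eq: "frechet_derivative f (at x) = frechet_derivative g (at x)" if "x \<in> S" for x
    by (rule frechet_derivative_transform_within_open[OF diff \<open>open S\<close>])
       (use that Suc.prems(1) in auto)
  have "Ck_on k S (\<lambda>x. frechet_derivative f (at x) v)" for v
    using Suc.prems(2) by simp
  then have "Ck_on k S (\<lambda>x. frechet_derivative g (at x) v)" for v
    by (rule Suc.IH[rotated]) (simp add: eq)
  moreover have "g differentiable_on S"
    unfolding differentiable_on_eq_differentiable_at[OF \<open>open S\<close>] differentiable_def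
  proof
    fix x assume x: "x \<in> S"
    from diff[OF x] obtain f' where "(f has_derivative f') (at x)" by (auto simp: differentiable_def)
    then have "(g has_derivative f') (at x)"
      by (rule has_derivative_transform_within_open[OF _ \<open>open S\<close> x Suc.prems(1)])
    then show "\<exists>D. (g has_derivative D) (at x)" by blast
  qed
  ultimately show ?case by simp
qed

text \<open>
  Lets a derivative found by the usual rules replace the derivative chosen by
  \<open>frechet_derivative\<close>; the closure properties below are inductions on \<open>k\<close> through this rule.
\<close>

lemma Ck_on_derivI:
  assumes S: "open S" and d: "\<And>x. x \<in> S \<Longrightarrow> (f has_derivative f' x) (at x)"
    and k: "\<And>v. Ck_on k S (\<lambda>x. f' x v)"
  shows "Ck_on (Suc k) S f"
proof -
  have "f' x = frechet_derivative f (at x)" if "x \<in> S" for x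
    using d[OF that] by (rule frechet_derivative_at)
  then have "Ck_on k S (\<lambda>x. frechet_derivative f (at x) v)" for v
    by (intro Ck_on_cong[OF S _ k[of v]]) simp
  moreover have "f differentiable_on S"
    using S d by (auto simp: differentiable_on_eq_differentiable_at differentiable_def)
  ultimately show ?thesis by simp
qed

lemma Ck_on_SucD: "open S \<Longrightarrow> Ck_on (Suc k) S f \<Longrightarrow> Ck_on k S f"
proof (induction k arbitrary: f)
  case 0
  then show ?case by (simp add: differentiable_imp_continuous_on)
next
  case (Suc k)
  then have "f differentiable_on S" "\<And>v. Ck_on (Suc k) S (\<lambda>x. frechet_derivative f (at x) v)"
    unfolding Ck_on.simps(2)[of "Suc k" S f] by blast+
  then show ?case
    unfolding Ck_on.simps(2)[of k S f] using Suc.IH[OF Suc.prems(1)] by blast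
qed

lemma Ck_on_subset:
  assumes "open T" "open S" "T \<subseteq> S" "Ck_on k S f"
  shows "Ck_on k T f"
  using assms(4)
proof (induction k arbitrary: f)
  case 0
  then show ?case using assms(3) continuous_on_subset by auto
next
  case (Suc k)
  then show ?case using assms(3) differentiable_on_subset by auto
qed

lemma Ck_on_local:
  assumes "open S" and "\<And>x. x \<in> S \<Longrightarrow> \<exists>T. open T \<and> x \<in> T \<and> T \<subseteq> S \<and> Ck_on k T f"
  shows "Ck_on k S f"
  using assms(2)
proof (induction k arbitrary: f)
  case 0
  have "isCont f x" if x: "x \<in> S" for x
  proof -
    obtain T where "open T" "x \<in> T" "continuous_on T f" using 0[OF x] by auto
    then show ?thesis by (simp add: continuous_on_eq_continuous_at)
  qed
  then show ?case by (simp add: continuous_at_imp_continuous_on)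
next
  case (Suc k)
  show ?case
  proof (rule Ck_on_derivI[OF \<open>open S\<close>])
    fix x assume x: "x \<in> S"
    obtain T where "open T" "x \<in> T" "Ck_on (Suc k) T f" using Suc.prems[OF x] by auto
    then show "(f has_derivative frechet_derivative f (at x)) (at x)"
      by (auto intro: Ck_on_has_derivative)
  next
    fix v show "Ck_on k S (\<lambda>x. frechet_derivative f (at x) v)"
    proof (rule Suc.IH)
      fix x assume x: "x \<in> S"
      show "\<exists>T. open T \<and> x \<in> T \<and> T \<subseteq> S \<and> Ck_on k T (\<lambda>x. frechet_derivative f (at x) v)"
        using Suc.prems[OF x] unfolding Ck_on.simps by blast
    qed
  qed
qed

lemma Ck_on_const: "open S \<Longrightarrow> Ck_on k S (\<lambda>x. c)"
proof (induction k arbitrary: c)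
  case (Suc k)
  then show ?case by (intro Ck_on_derivI[where f' = "\<lambda>x v. 0"]) auto
qed simp

lemma Ck_on_affine:
  assumes "open S" and L: "bounded_linear L"
  shows "Ck_on k S (\<lambda>x. c + L x)"
proof (cases k)
  case 0
  then show ?thesis
    using continuous_on_add[OF continuous_on_const linear_continuous_on[OF L]] by simp
next
  case (Suc j)
  have "((\<lambda>x. c + L x) has_derivative L) (at x)" for x
    using has_derivative_add[OF has_derivative_const bounded_linear_imp_has_derivative[OF L]]
    by simp
  then show ?thesis
    unfolding Suc by (intro Ck_on_derivI[OF \<open>open S\<close>]) (auto intro: Ck_on_const[OF \<open>open S\<close>])
qed

lemma Ck_on_compose_linear:
  assumes "open S" and L: "bounded_linear L" and "Ck_on k S f"
  shows "Ck_on k S (\<lambda>x. L (f x))"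
  using assms(3)
proof (induction k arbitrary: f)
  case 0
  then show ?case using L by (simp add: bounded_linear.continuous_on)
next
  case (Suc k)
  show ?case
  proof (rule Ck_on_derivI[OF \<open>open S\<close>])
    show "((\<lambda>x. L (f x)) has_derivative (\<lambda>v. L (frechet_derivative f (at x) v))) (at x)"
      if "x \<in> S" for x
      using bounded_linear.has_derivative[OF L Ck_on_has_derivative[OF \<open>open S\<close> Suc.prems that]] .
  qed (use Suc in auto)
qed

lemma Ck_on_add:
  assumes "open S" "Ck_on k S f" "Ck_on k S g"
  shows "Ck_on k S (\<lambda>x. f x + g x)"
  using assms(2,3)
proof (induction k arbitrary: f g)
  case 0
  then show ?case by (simp add: continuous_on_add)
next
  case (Suc k)
  show ?case
  proof (rule Ck_on_derivI[OF \<open>open S\<close>])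
    show "((\<lambda>x. f x + g x) has_derivative
        (\<lambda>v. frechet_derivative f (at x) v + frechet_derivative g (at x) v)) (at x)"
      if "x \<in> S" for x
      using that Suc.prems by (intro has_derivative_add Ck_on_has_derivative[OF \<open>open S\<close>]) auto
  qed (use Suc in auto)
qed

lemma Ck_on_sum:
  assumes "open S" "\<And>i. i \<in> I \<Longrightarrow> Ck_on k S (f i)"
  shows "Ck_on k S (\<lambda>x. \<Sum>i\<in>I. f i x)"
  using assms(2)
  by (induction I rule: infinite_finite_induct) (auto intro: Ck_on_add Ck_on_const assms(1))

lemma Ck_on_scaleR:
  assumes "open S" "Ck_on k S f" "Ck_on k S g"
  shows "Ck_on k S (\<lambda>x. f x *\<^sub>R g x)"
  using assms(2,3)
proof (induction k arbitrary: f g)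
  case 0
  then show ?case by (simp add: continuous_on_scaleR)
next
  case (Suc k)
  show ?case
  proof (rule Ck_on_derivI[OF \<open>open S\<close>])
    show "((\<lambda>x. f x *\<^sub>R g x) has_derivative
        (\<lambda>v. f x *\<^sub>R frechet_derivative g (at x) v + frechet_derivative f (at x) v *\<^sub>R g x)) (at x)"
      if "x \<in> S" for x
      using that Suc.prems by (intro has_derivative_scaleR Ck_on_has_derivative[OF \<open>open S\<close>]) auto
    show "Ck_on k S (\<lambda>x. f x *\<^sub>R frechet_derivative g (at x) v + frechet_derivative f (at x) v *\<^sub>R g x)"
      for v
      using Suc.prems Ck_on_SucD[OF \<open>open S\<close> Suc.prems(1)] Ck_on_SucD[OF \<open>open S\<close> Suc.prems(2)]
      by (intro Ck_on_add \<open>open S\<close> Suc.IH) simp_all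
  qed
qed

text \<open>
  In coordinates the chain rule reads \<open>D_v (g \<circ> h) = \<Sum>b. (D_v h)_b \<cdot> (D_b g) \<circ> h\<close>. On the right, each
  \<open>(D_b g) \<circ> h\<close> is of class \<open>C^k\<close> by the induction hypothesis, and the rest is a sum of products.
  The finite orthonormal basis of the middle space is what turns the bilinear expression
  \<open>Dg(h(x))(Dh(x) v)\<close> into products of functions that are known to be \<open>C^k\<close>.
\<close>

lemma Ck_on_compose:
  fixes h :: "'a::real_normed_vector \<Rightarrow> 'b::euclidean_space"
    and g :: "'b \<Rightarrow> 'c::real_normed_vector"
  assumes S: "open S" and T: "open T" and sub: "h ` S \<subseteq> T" and "Ck_on k S h" "Ck_on k T g"
  shows "Ck_on k S (\<lambda>x. g (h x))"
  using assms(4,5)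
proof (induction k arbitrary: g)
  case 0
  then show ?case using continuous_on_compose2[OF _ _ sub] by auto
next
  case (Suc k)
  let ?h' = "\<lambda>x. frechet_derivative h (at x)" and ?g' = "\<lambda>x. frechet_derivative g (at x)"
  show ?case
  proof (rule Ck_on_derivI[OF S])
    fix x assume x: "x \<in> S"
    then have g': "(g has_derivative ?g' (h x)) (at (h x))"
      using sub by (intro Ck_on_has_derivative[OF T Suc.prems(2)]) auto
    have "((\<lambda>x. g (h x)) has_derivative (\<lambda>v. ?g' (h x) (?h' x v))) (at x)"
      using has_derivative_compose[OF Ck_on_has_derivative[OF S Suc.prems(1) x] g'] .
    also have "(\<lambda>v. ?g' (h x) (?h' x v)) = (\<lambda>v. \<Sum>b\<in>Basis. (?h' x v \<bullet> b) *\<^sub>R ?g' (h x) b)"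
    proof
      fix v
      let ?w = "?h' x v"
      have lin: "linear (?g' (h x))" using g' by (rule has_derivative_linear)
      have "?g' (h x) ?w = ?g' (h x) (\<Sum>b\<in>Basis. (?w \<bullet> b) *\<^sub>R b)"
        by (simp only: euclidean_representation)
      also have "\<dots> = (\<Sum>b\<in>Basis. (?w \<bullet> b) *\<^sub>R ?g' (h x) b)"
        by (simp only: linear_sum[OF lin] linear_scale[OF lin])
      finally show "?g' (h x) ?w = (\<Sum>b\<in>Basis. (?w \<bullet> b) *\<^sub>R ?g' (h x) b)" .
    qed
    finally show "((\<lambda>x. g (h x)) has_derivative
        (\<lambda>v. \<Sum>b\<in>Basis. (?h' x v \<bullet> b) *\<^sub>R ?g' (h x) b)) (at x)" .
  next
    fix v
    have "Ck_on k S h" using Ck_on_SucD[OF S Suc.prems(1)] .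
    then have "Ck_on k S (\<lambda>x. ?g' (h x) b)" for b
      using Suc.prems(2) by (intro Suc.IH[of "\<lambda>y. ?g' y b"]) simp_all
    moreover have "Ck_on k S (\<lambda>x. ?h' x v \<bullet> b)" for b
      using Suc.prems(1) by (intro Ck_on_compose_linear[OF S bounded_linear_inner_left]) simp
    ultimately show "Ck_on k S (\<lambda>x. \<Sum>b\<in>Basis. (?h' x v \<bullet> b) *\<^sub>R ?g' (h x) b)"
      by (intro Ck_on_sum[OF S] Ck_on_scaleR[OF S])
  qed
qed

lemma Cinf_on_cong:
  "open S \<Longrightarrow> (\<And>x. x \<in> S \<Longrightarrow> f x = g x) \<Longrightarrow> Cinf_on S f \<Longrightarrow> Cinf_on S g"
  unfolding Cinf_on_def using Ck_on_cong by blast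

lemma Cinf_on_subset: "open T \<Longrightarrow> open S \<Longrightarrow> T \<subseteq> S \<Longrightarrow> Cinf_on S f \<Longrightarrow> Cinf_on T f"
  unfolding Cinf_on_def using Ck_on_subset by blast

lemma Cinf_on_local:
  "open S \<Longrightarrow> (\<And>x. x \<in> S \<Longrightarrow> \<exists>T. open T \<and> x \<in> T \<and> T \<subseteq> S \<and> Cinf_on T f) \<Longrightarrow> Cinf_on S f"
  unfolding Cinf_on_def by (meson Ck_on_local)

lemma Cinf_on_compose:
  fixes h :: "'a::real_normed_vector \<Rightarrow> 'b::euclidean_space"
    and g :: "'b \<Rightarrow> 'c::real_normed_vector"
  shows "open S \<Longrightarrow> open T \<Longrightarrow> h ` S \<subseteq> T \<Longrightarrow> Cinf_on S h \<Longrightarrow> Cinf_on T g \<Longrightarrow> Cinf_on S (\<lambda>x. g (h x))"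
  unfolding Cinf_on_def using Ck_on_compose by blast

lemma Cinf_on_affine: "open S \<Longrightarrow> bounded_linear L \<Longrightarrow> Cinf_on S (\<lambda>x. c + L x)"
  unfolding Cinf_on_def using Ck_on_affine by blast

lemma Cinf_on_continuous: "Cinf_on S f \<Longrightarrow> continuous_on S f"
  unfolding Cinf_on_def using Ck_on.simps(1) by blast

lemma Cinf_on_has_derivative:
  "open S \<Longrightarrow> Cinf_on S f \<Longrightarrow> x \<in> S \<Longrightarrow> (f has_derivative frechet_derivative f (at x)) (at x)"
  unfolding Cinf_on_def using Ck_on_has_derivative by blast

lemma Cinf_on_directional: "Cinf_on S f \<Longrightarrow> Cinf_on S (\<lambda>x. frechet_derivative f (at x) v)"
  unfolding Cinf_on_def using Ck_on.simps(2) by blast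

section \<open>Smooth functions in charts\<close>

context smooth_manifold
begin

lemma chart_domain: "(U, \<phi>) \<in> atlas M \<Longrightarrow> U \<subseteq> pts M"
  using chart_open openin_subset by blast

lemma chart_at:
  assumes "m \<in> pts M"
  obtains U \<phi> where "(U, \<phi>) \<in> atlas M" "m \<in> U"
  using assms charts_cover by auto

lemma chart_inj: "(U, \<phi>) \<in> atlas M \<Longrightarrow> inj_on \<phi> U"
  using chart_homeomorphic[of U \<phi>] chart_domain[of U \<phi>]
  by (simp add: homeomorphic_eq_everything_map inf_absorb2)

lemma chart_inv [simp]: "(U, \<phi>) \<in> atlas M \<Longrightarrow> x \<in> U \<Longrightarrow> inv_into U \<phi> (\<phi> x) = x"
  using chart_inj by (rule inv_into_f_f)

lemma chart_preimage_open:
  assumes c: "(U, \<phi>) \<in> atlas M" and "open A"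
  shows "openin (mtop M) {x \<in> U. \<phi> x \<in> A}"
proof -
  have "continuous_map (subtopology (mtop M) U) euclidean \<phi>"
    using chart_homeomorphic[OF c] by (simp add: homeomorphic_eq_everything_map continuous_map_in_subtopology)
  then have "openin (subtopology (mtop M) U) {x \<in> topspace (subtopology (mtop M) U). \<phi> x \<in> A}"
    using \<open>open A\<close> by (intro openin_continuous_map_preimage) auto
  also have "{x \<in> topspace (subtopology (mtop M) U). \<phi> x \<in> A} = {x \<in> U. \<phi> x \<in> A}"
    using chart_domain[OF c] by auto
  finally show ?thesis using openin_open_subtopology[OF chart_open[OF c]] by simp
qed

lemma chart_image_open_subset:
  assumes c: "(U, \<phi>) \<in> atlas M" and V: "openin (mtop M) V"
  shows "open (\<phi> ` (U \<inter> V))"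
proof -
  have "open_map (subtopology (mtop M) U) (top_of_set (\<phi> ` U)) \<phi>"
    using chart_homeomorphic[OF c] by (simp add: homeomorphic_eq_everything_map)
  moreover have "openin (subtopology (mtop M) U) (U \<inter> V)"
    using V openin_subtopology_Int2 by blast
  ultimately have "openin (top_of_set (\<phi> ` U)) (\<phi> ` (U \<inter> V))"
    unfolding open_map_def by blast
  then show ?thesis using chart_image_open[OF c] by (simp add: openin_open_eq)
qed

text \<open>
  A function that is smooth in all charts is continuous, since the charts are homeomorphisms whose
  domains cover the manifold. Closure properties of \<open>Cinf\<close> thereby reduce to those of \<open>Cinf_on\<close>.
\<close>

lemma Cinf_iff:
  assumes W: "openin (mtop M) W"
  shows "f \<in> Cinf M W \<longleftrightarrow> (\<forall>(U, \<phi>)\<in>atlas M. Cinf_on (\<phi> ` (U \<inter> W)) (\<lambda>y. f (inv_into U \<phi> y)))"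
    (is "_ \<longleftrightarrow> ?charts")
proof
  assume f: "f \<in> Cinf M W"
  then show ?charts
    by (auto simp: Cinf_def smooth_map_on_def eucl_def o_def Int_def)
next
  assume charts: ?charts
  have "continuous_map (subtopology (mtop M) W) euclidean f"
    unfolding continuous_map
  proof (intro conjI allI impI)
    fix T :: "real set" assume "openin euclidean T"
    then have T: "open T" by simp
    have loc: "openin (mtop M) {x \<in> U \<inter> W. f x \<in> T}" if c: "(U, \<phi>) \<in> atlas M" for U \<phi>
    proof -
      let ?f = "\<lambda>y. f (inv_into U \<phi> y)"
      let ?A = "\<phi> ` (U \<inter> W) \<inter> ?f -` T"
      have "continuous_on (\<phi> ` (U \<inter> W)) ?f"
        using charts c by (auto intro: Cinf_on_continuous)
      then have "open ?A"
        by (intro continuous_open_preimage[OF _ chart_image_open_subset[OF c W] T])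
      moreover have "{x \<in> U \<inter> W. f x \<in> T} = {x \<in> U. \<phi> x \<in> ?A}"
        using c chart_inj[OF c] by (auto simp: inj_on_eq_iff)
      ultimately show ?thesis by (simp only: chart_preimage_open[OF c])
    qed
    have "{x \<in> W. f x \<in> T} = (\<Union>(U, \<phi>)\<in>atlas M. {x \<in> U \<inter> W. f x \<in> T})"
      using openin_subset[OF W] charts_cover by auto
    also have "openin (mtop M) \<dots>" using loc by (intro openin_Union) auto
    finally have "openin (mtop M) {x \<in> W. f x \<in> T}" .
    then show "openin (subtopology (mtop M) W) {x \<in> topspace (subtopology (mtop M) W). f x \<in> T}"
      using openin_subset[OF W] openin_open_subtopology[OF W]
      by (simp add: inf_absorb2 subset_iff)
  qed simp
  then show "f \<in> Cinf M W"
    using charts by (auto simp: Cinf_def smooth_map_on_def eucl_def o_def Int_def)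
qed

lemma Cinf_cong:
  assumes "openin (mtop M) W" and "f \<in> Cinf M W" and "\<And>x. x \<in> W \<Longrightarrow> f x = g x"
  shows "g \<in> Cinf M W"
  unfolding Cinf_iff[OF assms(1)]
proof clarify
  fix U \<phi> assume c: "(U, \<phi>) \<in> atlas M"
  show "Cinf_on (\<phi> ` (U \<inter> W)) (\<lambda>y. g (inv_into U \<phi> y))"
  proof (rule Cinf_on_cong[OF chart_image_open_subset[OF c assms(1)]])
    show "Cinf_on (\<phi> ` (U \<inter> W)) (\<lambda>y. f (inv_into U \<phi> y))"
      using assms(2) c unfolding Cinf_iff[OF assms(1)] by blast
  qed (use c assms(3) in auto)
qed

lemma Cinf_subset:
  assumes "openin (mtop M) W" "openin (mtop M) V" "V \<subseteq> W" "f \<in> Cinf M W"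
  shows "f \<in> Cinf M V"
  unfolding Cinf_iff[OF assms(2)]
proof clarify
  fix U \<phi> assume c: "(U, \<phi>) \<in> atlas M"
  show "Cinf_on (\<phi> ` (U \<inter> V)) (\<lambda>y. f (inv_into U \<phi> y))"
    by (rule Cinf_on_subset[OF chart_image_open_subset[OF c assms(2)]
          chart_image_open_subset[OF c assms(1)]])
       (use assms(3,4) c in \<open>auto simp: Cinf_iff[OF assms(1)]\<close>)
qed

lemma Cinf_add:
  assumes W: "openin (mtop M) W" and "f \<in> Cinf M W" "g \<in> Cinf M W"
  shows "(\<lambda>m. f m + g m) \<in> Cinf M W"
  using assms(2,3) chart_image_open_subset[OF _ W]
  by (auto simp: Cinf_iff[OF W] Cinf_on_def intro!: Ck_on_add)

lemma Cinf_mult: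
  assumes W: "openin (mtop M) W" and "f \<in> Cinf M W" "g \<in> Cinf M W"
  shows "(\<lambda>m. f m * g m) \<in> Cinf M W"
  unfolding real_scaleR_def[symmetric] using assms(2,3) chart_image_open_subset[OF _ W]
  by (auto simp: Cinf_iff[OF W] Cinf_on_def simp del: real_scaleR_def intro!: Ck_on_scaleR)

lemma Cinf_const: "openin (mtop M) W \<Longrightarrow> (\<lambda>m. c) \<in> Cinf M W"
  using chart_image_open_subset by (auto simp: Cinf_iff Cinf_on_def intro!: Ck_on_const)

lemma Cinf_diff:
  assumes W: "openin (mtop M) W" and "f \<in> Cinf M W" "g \<in> Cinf M W"
  shows "(\<lambda>m. f m - g m) \<in> Cinf M W"
  using Cinf_add[OF W assms(2) Cinf_mult[OF W Cinf_const[OF W, of "-1"] assms(3)]] by simp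

end

section \<open>Tangent and cotangent spaces\<close>

text \<open>
  The vector with coordinates \<open>u\<close> in the chart, acting as a directional derivative. Like all tangent
  vectors, it is zero on functions that are not smooth near \<open>m\<close>.
\<close>

definition chart_vector ::
  "('m, 'e::real_normed_vector) mfd \<Rightarrow> 'm set \<Rightarrow> ('m \<Rightarrow> 'e) \<Rightarrow> 'm \<Rightarrow> 'e \<Rightarrow> 'm tvec" where
  "chart_vector M U \<phi> m u = (\<lambda>f. if smooth_near M m f
     then frechet_derivative (\<lambda>y. f (inv_into U \<phi> y)) (at (\<phi> m)) u else 0)"

context smooth_manifold
begin

lemma smooth_near_has_derivative:
  assumes "smooth_near M m f" and c: "(U, \<phi>) \<in> atlas M" "m \<in> U"
  shows "((\<lambda>y. f (inv_into U \<phi> y)) has_derivative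
    frechet_derivative (\<lambda>y. f (inv_into U \<phi> y)) (at (\<phi> m))) (at (\<phi> m))"
proof -
  obtain W where W: "openin (mtop M) W" "m \<in> W" "f \<in> Cinf M W"
    using assms(1) by (auto simp: smooth_near_def)
  show ?thesis
    by (rule Cinf_on_has_derivative[OF chart_image_open_subset[OF c(1) W(1)]])
       (use W c Cinf_iff[OF W(1)] in auto)
qed

lemma chart_vector_linear:
  assumes c: "(U, \<phi>) \<in> atlas M" "m \<in> U"
  shows "(\<lambda>f. a * chart_vector M U \<phi> m u f + b * chart_vector M U \<phi> m w f)
    = chart_vector M U \<phi> m (a *\<^sub>R u + b *\<^sub>R w)"
proof
  fix f
  show "a * chart_vector M U \<phi> m u f + b * chart_vector M U \<phi> m w f
    = chart_vector M U \<phi> m (a *\<^sub>R u + b *\<^sub>R w) f"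
  proof (cases "smooth_near M m f")
    case True
    have lin: "linear (frechet_derivative (\<lambda>y. f (inv_into U \<phi> y)) (at (\<phi> m)))"
      using smooth_near_has_derivative[OF True c] by (rule has_derivative_linear)
    show ?thesis
      using True by (simp add: chart_vector_def linear_add[OF lin] linear_scale[OF lin])
  qed (simp add: chart_vector_def)
qed

text \<open>
  The chain rule for \<open>f \<circ> \<gamma> = (f \<circ> \<phi>\<^sup>-\<^sup>1) \<circ> (\<phi> \<circ> \<gamma>)\<close>: the velocity depends on the curve only through the derivative
  of its coordinates.
\<close>

lemma velocity_in_chart:
  assumes c: "(U, \<phi>) \<in> atlas M" and T: "open T" "0 \<in> T" "\<gamma> ` T \<subseteq> U"
    and d: "((\<lambda>t. \<phi> (\<gamma> t)) has_derivative c') (at 0)"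
  shows "velocity M \<gamma> = chart_vector M U \<phi> (\<gamma> 0) (c' 1)"
proof
  fix f
  show "velocity M \<gamma> f = chart_vector M U \<phi> (\<gamma> 0) (c' 1) f"
  proof (cases "smooth_near M (\<gamma> 0) f")
    case True
    have U0: "\<gamma> 0 \<in> U" using T by auto
    let ?F' = "frechet_derivative (\<lambda>y. f (inv_into U \<phi> y)) (at (\<phi> (\<gamma> 0)))"
    note F = smooth_near_has_derivative[OF True c U0]
    have "((\<lambda>t. f (inv_into U \<phi> (\<phi> (\<gamma> t)))) has_derivative (\<lambda>t. ?F' (c' t))) (at 0)"
      using has_derivative_compose[OF d F] .
    then have "((f \<circ> \<gamma>) has_derivative (\<lambda>t. ?F' (c' t))) (at 0)"
      by (rule has_derivative_transform_within_open[OF _ T(1,2)]) (use T(3) c in auto)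
    also have "(\<lambda>t. ?F' (c' t)) = (*) (?F' (c' 1))"
    proof
      fix t
      have "c' t = t *\<^sub>R c' 1" using linear_scale[OF has_derivative_linear[OF d], of t 1] by simp
      then show "?F' (c' t) = ?F' (c' 1) * t"
        by (simp only: linear_scale[OF has_derivative_linear[OF F]]) simp
    qed
    finally have "((f \<circ> \<gamma>) has_field_derivative ?F' (c' 1)) (at 0)"
      by (simp add: has_field_derivative_def o_def)
    then show ?thesis using True by (simp add: velocity_def chart_vector_def DERIV_imp_deriv)
  qed (simp add: velocity_def chart_vector_def)
qed

lemma smooth_curve_continuous:
  assumes "smooth_map_on eucl M I \<gamma>" and "open I" and "openin (mtop M) W"
  shows "open {t \<in> I. \<gamma> t \<in> W}"
proof -
  have "continuous_map (top_of_set I) (mtop M) \<gamma>"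
    using assms(1) by (simp add: smooth_map_on_def eucl_def)
  then have "openin (top_of_set I) {t \<in> I. \<gamma> t \<in> W}"
    using openin_continuous_map_preimage[OF _ assms(3)] by fastforce
  then show ?thesis using assms(2) by (simp add: openin_open_eq)
qed

lemma tangent_vector_in_chart:
  assumes v: "v \<in> tangent_space M m" and c: "(U, \<phi>) \<in> atlas M" "m \<in> U"
  shows "\<exists>u. v = chart_vector M U \<phi> m u"
proof -
  obtain \<gamma> \<epsilon> where \<gamma>: "v = velocity M \<gamma>" "\<gamma> 0 = m" "\<epsilon> > 0" "smooth_map_on eucl M {-\<epsilon><..<\<epsilon>} \<gamma>"
    using v by (auto simp: tangent_space_def)
  let ?T = "{t \<in> {-\<epsilon><..<\<epsilon>}. \<gamma> t \<in> U}"
  have T: "open ?T" using smooth_curve_continuous[OF \<gamma>(4) _ chart_open[OF c(1)]] by simp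
  have "Cinf_on ?T (\<lambda>t. \<phi> (\<gamma> t))"
    using \<gamma>(4) c(1) by (auto simp: smooth_map_on_def eucl_def o_def)
  then have "((\<lambda>t. \<phi> (\<gamma> t)) has_derivative frechet_derivative (\<lambda>t. \<phi> (\<gamma> t)) (at 0)) (at 0)"
    using T \<gamma>(2,3) c(2) by (intro Cinf_on_has_derivative) auto
  from velocity_in_chart[OF c(1) T _ _ this] show ?thesis using \<gamma> c(2) by auto
qed

lemma chart_inverse_continuous:
  assumes c: "(U, \<phi>) \<in> atlas M"
  shows "continuous_map (top_of_set (\<phi> ` U)) (mtop M) (inv_into U \<phi>)"
  unfolding continuous_map
proof (intro conjI allI impI)
  show "inv_into U \<phi> ` topspace (top_of_set (\<phi> ` U)) \<subseteq> pts M"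
    using chart_domain[OF c] c by auto
  fix W assume W: "openin (mtop M) W"
  have "{y \<in> topspace (top_of_set (\<phi> ` U)). inv_into U \<phi> y \<in> W} = \<phi> ` (U \<inter> W)"
    using c by auto
  then show "openin (top_of_set (\<phi> ` U)) {y \<in> topspace (top_of_set (\<phi> ` U)). inv_into U \<phi> y \<in> W}"
    using chart_image_open_subset[OF c W] by (auto intro!: open_subset)
qed

end

text \<open>
  The inner product of the model space is only a device for the chain rule \<open>Ck_on_compose\<close>, by which
  curves and actions that are given in one chart are seen to be smooth in another.
\<close>

locale euclidean_manifold = smooth_manifold M for M :: "('m, 'e::euclidean_space) mfd"
begin

text \<open>
  Together with \<open>tangent_vector_in_chart\<close> this identifies the tangent space at \<open>m\<close> with the model
  space, and is the reason why velocities of curves form a vector space at all. The curve is the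
  straight line through \<open>\<phi> m\<close> with direction \<open>u\<close>, kept so short that it stays in the chart; it is smooth
  in any other chart because the change of charts is.
\<close>

lemma chart_vector_tangent:
  assumes c: "(U, \<phi>) \<in> atlas M" "m \<in> U"
  shows "chart_vector M U \<phi> m u \<in> tangent_space M m"
proof -
  define l where "l t = \<phi> m + t *\<^sub>R u" for t :: real
  define \<gamma> where "\<gamma> t = inv_into U \<phi> (l t)" for t
  have l_cont: "continuous_on A l" for A
    unfolding l_def by (intro continuous_intros)
  have vim: "open (l -` A)" if "open A" for A
    using open_vimage[OF that l_cont] .
  have "0 \<in> l -` (\<phi> ` U)" using c by (simp add: l_def)
  then obtain \<epsilon> where \<epsilon>: "\<epsilon> > 0" "ball 0 \<epsilon> \<subseteq> l -` (\<phi> ` U)"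
    using vim[OF chart_image_open[OF c(1)]] open_contains_ball by blast
  define I where "I = {-\<epsilon><..<\<epsilon>}"
  have I: "open I" "0 \<in> I" "l ` I \<subseteq> \<phi> ` U"
    using \<epsilon> by (auto simp: I_def ball_eq_greaterThanLessThan)
  have in_U: "\<gamma> t \<in> U" and \<phi>\<gamma>: "\<phi> (\<gamma> t) = l t" if "t \<in> I" for t
    using I(3) that by (auto simp: \<gamma>_def inv_into_into f_inv_into_f image_subset_iff)
  have "smooth_map_on eucl M I \<gamma>"
    unfolding smooth_map_on_def
  proof (intro conjI)
    have "continuous_map (top_of_set I) (top_of_set (\<phi> ` U)) l"
      using l_cont I(3) by auto
    from continuous_map_compose[OF this chart_inverse_continuous[OF c(1)]]
    show "continuous_map (subtopology (mtop eucl) I) (mtop M) \<gamma>"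
      by (simp add: eucl_def o_def \<gamma>_def[abs_def])
    have "Cinf_on {t \<in> I. \<gamma> t \<in> V} (\<lambda>t. \<psi> (\<gamma> t))" if V: "(V, \<psi>) \<in> atlas M" for V \<psi>
    proof -
      have eq: "{t \<in> I. \<gamma> t \<in> V} = I \<inter> l -` (\<phi> ` (U \<inter> V))"
      proof (intro equalityI subsetI)
        fix t assume "t \<in> {t \<in> I. \<gamma> t \<in> V}"
        then have "t \<in> I" "l t = \<phi> (\<gamma> t)" "\<gamma> t \<in> U \<inter> V" using in_U \<phi>\<gamma> by auto
        then show "t \<in> I \<inter> l -` (\<phi> ` (U \<inter> V))" by blast
      next
        fix t assume "t \<in> I \<inter> l -` (\<phi> ` (U \<inter> V))"
        then show "t \<in> {t \<in> I. \<gamma> t \<in> V}" using c(1) by (auto simp: \<gamma>_def)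
      qed
      have op: "open (\<phi> ` (U \<inter> V))" using chart_image_open_subset[OF c(1) chart_open[OF V]] .
      have T: "open {t \<in> I. \<gamma> t \<in> V}" unfolding eq using I(1) vim[OF op] by auto
      have "Cinf_on {t \<in> I. \<gamma> t \<in> V} l"
        unfolding l_def[abs_def] by (rule Cinf_on_affine[OF T bounded_linear_scaleR_left])
      moreover have "Cinf_on (\<phi> ` (U \<inter> V)) (\<lambda>y. \<psi> (inv_into U \<phi> y))"
        using charts_compatible[OF c(1) V] by (simp add: o_def)
      moreover have "l ` {t \<in> I. \<gamma> t \<in> V} \<subseteq> \<phi> ` (U \<inter> V)" unfolding eq by blast
      ultimately show ?thesis
        using Cinf_on_compose[OF T op] by (simp add: \<gamma>_def)
    qed
    then show "\<forall>(U, \<phi>)\<in>atlas eucl. \<forall>(V, \<psi>)\<in>atlas M.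
        Cinf_on (\<phi> ` {t \<in> U \<inter> I. \<gamma> t \<in> V}) (\<psi> \<circ> \<gamma> \<circ> inv_into U \<phi>)"
      by (auto simp: eucl_def o_def)
  qed
  moreover have "\<gamma> 0 = m" using c by (simp add: \<gamma>_def l_def)
  moreover have "velocity M \<gamma> = chart_vector M U \<phi> (\<gamma> 0) (1 *\<^sub>R u)"
  proof (rule velocity_in_chart[OF c(1) I(1,2)])
    have "(l has_derivative (\<lambda>t. t *\<^sub>R u)) (at 0)"
      unfolding l_def by (auto intro!: derivative_eq_intros)
    then show "((\<lambda>t. \<phi> (\<gamma> t)) has_derivative (\<lambda>t. t *\<^sub>R u)) (at 0)"
      by (rule has_derivative_transform_within_open[OF _ I(1,2)]) (simp add: \<phi>\<gamma>)
  qed (use in_U in auto)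
  ultimately have "velocity M \<gamma> \<in> tangent_space M m" "velocity M \<gamma> = chart_vector M U \<phi> m u"
    unfolding tangent_space_def I_def using \<epsilon>(1) by (blast, simp)
  then show ?thesis by simp
qed

lemma tangent_vector_base_point: "v \<in> tangent_space M m \<Longrightarrow> m \<in> pts M"
  by (force simp: tangent_space_def smooth_map_on_def eucl_def continuous_map_def)

lemma tangent_lincomb:
  assumes "v \<in> tangent_space M m" "w \<in> tangent_space M m"
  shows "(\<lambda>f. a * v f + b * w f) \<in> tangent_space M m"
proof -
  obtain U \<phi> where c: "(U, \<phi>) \<in> atlas M" "m \<in> U"
    using chart_at tangent_vector_base_point[OF assms(1)] by metis
  obtain u u' where "v = chart_vector M U \<phi> m u" "w = chart_vector M U \<phi> m u'"
    using tangent_vector_in_chart[OF _ c] assms by metis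
  then show ?thesis
    using chart_vector_linear[OF c] chart_vector_tangent[OF c] by simp
qed

lemma zero_tangent:
  assumes "m \<in> pts M"
  shows "(\<lambda>f. 0) \<in> tangent_space M m"
proof -
  obtain U \<phi> where "(U, \<phi>) \<in> atlas M" "m \<in> U" using chart_at[OF assms] .
  then show ?thesis
    using tangent_lincomb[OF chart_vector_tangent chart_vector_tangent, of U \<phi> m U \<phi> 0 undefined 0 undefined]
    by simp
qed

lemma tangent_sum:
  assumes "m \<in> pts M" "\<And>i. i \<in> I \<Longrightarrow> v i \<in> tangent_space M m"
  shows "(\<lambda>f. \<Sum>i\<in>I. v i f) \<in> tangent_space M m"
  using assms(2)
proof (induction I rule: infinite_finite_induct)
  case (insert i I)
  then show ?case
    using tangent_lincomb[of "v i" m "\<lambda>f. \<Sum>i\<in>I. v i f" 1 1] by simp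
qed (use zero_tangent[OF assms(1)] in auto)

lemma covector_lincomb:
  "\<alpha> \<in> cotangent_space M m \<Longrightarrow> v \<in> tangent_space M m \<Longrightarrow> w \<in> tangent_space M m \<Longrightarrow>
    \<alpha> (\<lambda>f. a * v f + b * w f) = a * \<alpha> v + b * \<alpha> w"
  by (simp add: cotangent_space_def)

lemma covector_zero: 
  assumes "\<alpha> \<in> cotangent_space M m"
  shows "\<alpha> (\<lambda>f. 0) = 0"
proof (cases "(\<lambda>f. 0) \<in> tangent_space M m")
  case True
  then show ?thesis using covector_lincomb[OF assms True True, of 0 0] by simp
qed (use assms in \<open>auto simp: cotangent_space_def\<close>)

lemma covector_sum:
  assumes "m \<in> pts M" "\<alpha> \<in> cotangent_space M m" "\<And>i. i \<in> I \<Longrightarrow> v i \<in> tangent_space M m"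
  shows "\<alpha> (\<lambda>f. \<Sum>i\<in>I. v i f) = (\<Sum>i\<in>I. \<alpha> (v i))"
  using assms(3)
proof (induction I rule: infinite_finite_induct)
  case (insert i I)
  then show ?case
    using covector_lincomb[OF assms(2), of "v i" "\<lambda>f. \<Sum>i\<in>I. v i f" 1 1] tangent_sum[OF assms(1), of I v]
    by simp
qed (use covector_zero[OF assms(2)] in auto)

text \<open>
  The function \<open>f\<close> is arbitrary here: a tangent vector is a functional on all functions, and evaluation at \<open>f\<close>
  is linear. For this reason the differentials separate tangent vectors without any cut-off functions.
\<close>

lemma differential_cotangent: "differential_at M f m \<in> cotangent_space M m"
  using tangent_lincomb by (auto simp: cotangent_space_def differential_at_def)

lemma covectors_separate:
  assumes "v \<in> tangent_space M m" "w \<in> tangent_space M m"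
    and "\<And>\<alpha>. \<alpha> \<in> cotangent_space M m \<Longrightarrow> \<alpha> v = \<alpha> w"
  shows "v = w"
proof
  fix f show "v f = w f"
    using assms(3)[OF differential_cotangent, of f] assms(1,2) by (simp add: differential_at_def)
qed

end

section \<open>Restriction of fields and pairings\<close>

definition restrict_field :: "'m set \<Rightarrow> ('m \<Rightarrow> 'x \<Rightarrow> real) \<Rightarrow> 'm \<Rightarrow> 'x \<Rightarrow> real" where
  "restrict_field U X = (\<lambda>m. if m \<in> U then X m else (\<lambda>_. 0))"

lemma restrict_field_in [simp]: "m \<in> U \<Longrightarrow> restrict_field U X m = X m"
  by (simp add: restrict_field_def)

context euclidean_manifold
begin

lemma Vect_restrict:
  assumes U: "openin (mtop M) U" "U \<subseteq> W" and X: "X \<in> Vect M W"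
  shows "restrict_field U X \<in> Vect M U"
  unfolding Vect_def
proof (intro CollectI conjI allI ballI impI)
  fix V f assume V: "openin (mtop M) V \<and> V \<subseteq> U" and f: "f \<in> Cinf M V"
  then have "(\<lambda>m. X m f) \<in> Cinf M V" using X U by (auto simp: Vect_def)
  then show "(\<lambda>m. restrict_field U X m f) \<in> Cinf M V"
    by (rule Cinf_cong[rotated]) (use V in auto)
qed (use X U in \<open>auto simp: Vect_def restrict_field_def\<close>)

lemma Omega1_restrict:
  assumes U: "openin (mtop M) U" "U \<subseteq> W" and \<alpha>: "\<alpha> \<in> Omega1 M W"
  shows "restrict_field U \<alpha> \<in> Omega1 M U"
  unfolding Omega1_def
proof (intro CollectI conjI allI ballI impI)
  fix V X assume V: "openin (mtop M) V \<and> V \<subseteq> U" and X: "X \<in> Vect M V"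
  then have "(\<lambda>m. \<alpha> m (X m)) \<in> Cinf M V" using \<alpha> U by (auto simp: Omega1_def)
  then show "(\<lambda>m. restrict_field U \<alpha> m (X m)) \<in> Cinf M V"
    by (rule Cinf_cong[rotated]) (use V in auto)
qed (use \<alpha> U in \<open>auto simp: Omega1_def restrict_field_def\<close>)

lemma pairing_smooth:
  assumes U: "openin (mtop M) U" "U \<subseteq> V" "U \<subseteq> W" and \<alpha>: "\<alpha> \<in> Omega1 M V" and X: "X \<in> Vect M W"
  shows "(\<lambda>m. \<alpha> m (X m)) \<in> Cinf M U"
proof -
  have "(\<lambda>m. \<alpha> m (restrict_field U X m)) \<in> Cinf M U"
    using \<alpha> U Vect_restrict[OF U(1,3) X] by (auto simp: Omega1_def)
  then show ?thesis by (rule Cinf_cong[OF U(1)]) simp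
qed

text \<open>
  Differentials of local functions are the test forms by which smoothness of \<open>P#(\<tau>)\<close> is deduced
  from that of \<open>P\<close>.
\<close>

lemma differential_smooth:
  assumes U: "openin (mtop M) U" and f: "f \<in> Cinf M U"
  shows "restrict_field U (differential_at M f) \<in> Omega1 M U"
  unfolding Omega1_def
proof (intro CollectI conjI allI ballI impI)
  fix V X assume V: "openin (mtop M) V \<and> V \<subseteq> U" and X: "X \<in> Vect M V"
  have "(\<lambda>m. X m f) \<in> Cinf M V"
    using X V Cinf_subset[OF U _ _ f] by (auto simp: Vect_def)
  then show "(\<lambda>m. restrict_field U (differential_at M f) m (X m)) \<in> Cinf M V"
    by (rule Cinf_cong[rotated]) (use V X in \<open>auto simp: Vect_def differential_at_def\<close>)
qed (use differential_cotangent in \<open>auto simp: restrict_field_def\<close>)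

text \<open>
  The horizontal part \<open>X - \<tau>(X) \<kappa>\<close> of a vector field has this form.
\<close>

lemma Vect_minus_scaled:
  assumes X: "X \<in> Vect M (pts M)" and Y: "Y \<in> Vect M (pts M)" and a: "a \<in> Cinf M (pts M)"
  shows "(\<lambda>m f. X m f - a m * Y m f) \<in> Vect M (pts M)"
  unfolding Vect_def
proof (intro CollectI conjI allI ballI impI)
  fix m assume m: "m \<in> pts M"
  then show "(\<lambda>f. X m f - a m * Y m f) \<in> tangent_space M m"
    using tangent_lincomb[of "X m" m "Y m" 1 "- a m"] X Y by (simp add: Vect_def)
next
  fix V f assume V: "openin (mtop M) V \<and> V \<subseteq> pts M" and f: "f \<in> Cinf M V"
  then show "(\<lambda>m. X m f - a m * Y m f) \<in> Cinf M V"
    using X Y Cinf_subset[OF openin_topspace _ _ a]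
    by (intro Cinf_diff Cinf_mult) (auto simp: Vect_def)
qed (use X Y in \<open>auto simp: Vect_def\<close>)

end

section \<open>The Carroll vector field\<close>

locale euclidean_R_bundle = principal_R_bundle M S \<pi> act
  for M :: "('m, 'e::euclidean_space) mfd" and S :: "('s, 'f::real_normed_vector) mfd"
    and \<pi> :: "'m \<Rightarrow> 's" and act :: "'m \<Rightarrow> real \<Rightarrow> 'm"

sublocale euclidean_R_bundle \<subseteq> euclidean_manifold M
  by unfold_locales

context euclidean_R_bundle
begin

text \<open>
  The points \<open>(y, t)\<close> such that the action, read in the chart \<open>\<phi>\<close> and applied for time \<open>t\<close>, ends in \<open>W\<close>. It is the
  domain on which the action followed by a chart or a function on \<open>W\<close> can be differentiated.
\<close>

definition action_domain :: "'m set \<Rightarrow> ('m \<Rightarrow> 'e) \<Rightarrow> 'm set \<Rightarrow> ('e \<times> real) set" where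
  "action_domain U \<phi> W = {(y, t). y \<in> \<phi> ` U \<and> act (inv_into U \<phi> y) t \<in> W}"

lemma action_continuous: "continuous_map (prod_topology (mtop M) euclideanreal) (mtop M) (\<lambda>(m, t). act m t)"
proof -
  have "subtopology (prod_topology (mtop M) euclideanreal) (pts M \<times> UNIV)
      = prod_topology (mtop M) euclideanreal"
    by (rule subtopology_superset) simp
  then show ?thesis
    using action_smooth by (simp add: smooth_map_on_def prod_mfd_def eucl_def)
qed

lemma action_domain_open:
  assumes c: "(U, \<phi>) \<in> atlas M" and W: "openin (mtop M) W"
  shows "open (action_domain U \<phi> W)"
proof -
  let ?O = "\<phi> ` U \<times> (UNIV :: real set)"
  have "continuous_map (top_of_set ?O) (top_of_set (\<phi> ` U)) fst"
    by (auto intro!: continuous_intros)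
  from continuous_map_compose[OF this total.chart_inverse_continuous[OF c]]
  have "continuous_map (top_of_set ?O) (prod_topology (mtop M) euclideanreal)
      (\<lambda>p. (inv_into U \<phi> (fst p), snd p))"
    by (auto simp: continuous_map_pairwise o_def intro!: continuous_intros)
  from continuous_map_compose[OF this action_continuous]
  have "continuous_map (top_of_set ?O) (mtop M) (\<lambda>p. act (inv_into U \<phi> (fst p)) (snd p))"
    by (simp add: o_def)
  then have "openin (top_of_set ?O) {p \<in> topspace (top_of_set ?O). act (inv_into U \<phi> (fst p)) (snd p) \<in> W}"
    using W by (rule openin_continuous_map_preimage)
  moreover have "{p \<in> topspace (top_of_set ?O). act (inv_into U \<phi> (fst p)) (snd p) \<in> W} = action_domain U \<phi> W"
    by (auto simp: action_domain_def)
  moreover have "open ?O" using total.chart_image_open[OF c] by (intro open_Times) auto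
  ultimately show ?thesis by (simp add: openin_open_eq)
qed

lemma action_chart_smooth:
  assumes c: "(U, \<phi>) \<in> atlas M" and d: "(V, \<psi>) \<in> atlas M"
  shows "Cinf_on (action_domain U \<phi> V) (\<lambda>(y, t). \<psi> (act (inv_into U \<phi> y) t))"
proof -
  let ?\<Phi> = "map_prod \<phi> (id :: real \<Rightarrow> real)"
  have inj: "inj_on ?\<Phi> (U \<times> UNIV)"
    using total.chart_inj[OF c] by (simp add: map_prod_inj_on)
  have inv: "inv_into (U \<times> UNIV) ?\<Phi> (y, t) = (inv_into U \<phi> y, t)" if "y \<in> \<phi> ` U" for y t
  proof -
    have "?\<Phi> (inv_into U \<phi> y, t) = (y, t)" "(inv_into U \<phi> y, t) \<in> U \<times> UNIV"
      using that by (auto simp: f_inv_into_f inv_into_into)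
    then show ?thesis using inv_into_f_f[OF inj] by metis
  qed
  have "(U \<times> UNIV, ?\<Phi>) \<in> atlas (prod_mfd M eucl)"
    using c by (auto simp: prod_mfd_def eucl_def)
  then have smooth: "Cinf_on (?\<Phi> ` {x \<in> (U \<times> UNIV) \<inter> (pts M \<times> UNIV). (case x of (m, t) \<Rightarrow> act m t) \<in> V})
      (\<psi> \<circ> (\<lambda>(m, t). act m t) \<circ> inv_into (U \<times> UNIV) ?\<Phi>)"
    using action_smooth d unfolding smooth_map_on_def by fast
  have dom: "?\<Phi> ` {x \<in> (U \<times> UNIV) \<inter> (pts M \<times> UNIV). (case x of (m, t) \<Rightarrow> act m t) \<in> V}
      = action_domain U \<phi> V"
    using total.chart_domain[OF c] c by (force simp: action_domain_def image_iff)
  show ?thesis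
    by (rule Cinf_on_cong[OF action_domain_open[OF c total.chart_open[OF d]] _ smooth[unfolded dom]])
       (auto simp: action_domain_def inv simp del: total.chart_inv)
qed

text \<open>
  Near each point of the action domain the function factors as \<open>(f \<circ> \<psi>\<^sup>-\<^sup>1) \<circ> (\<psi> \<circ> act)\<close> through a chart \<open>\<psi>\<close> around
  the end point; both factors are smooth.
\<close>

lemma Cinf_along_action:
  assumes c: "(U, \<phi>) \<in> atlas M" and W: "openin (mtop M) W" and f: "f \<in> Cinf M W"
  shows "Cinf_on (action_domain U \<phi> W) (\<lambda>(y, t). f (act (inv_into U \<phi> y) t))"
proof (rule Cinf_on_local[OF action_domain_open[OF c W]])
  fix p assume p: "p \<in> action_domain U \<phi> W"
  then have "act (inv_into U \<phi> (fst p)) (snd p) \<in> pts M"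
    using openin_subset[OF W] by (auto simp: action_domain_def)
  then obtain V \<psi> where d: "(V, \<psi>) \<in> atlas M" "act (inv_into U \<phi> (fst p)) (snd p) \<in> V"
    using total.chart_at by blast
  let ?T = "action_domain U \<phi> (V \<inter> W)"
  have VW: "openin (mtop M) (V \<inter> W)" using total.chart_open[OF d(1)] W by blast
  have T: "open ?T" "?T \<subseteq> action_domain U \<phi> V" "?T \<subseteq> action_domain U \<phi> W" "p \<in> ?T"
    using action_domain_open[OF c VW] p d(2) by (auto simp: action_domain_def)
  have "Cinf_on ?T (\<lambda>(y, t). \<psi> (act (inv_into U \<phi> y) t))"
    by (rule Cinf_on_subset[OF T(1) action_domain_open[OF c total.chart_open[OF d(1)]] T(2)
        action_chart_smooth[OF c d(1)]])
  moreover have "Cinf_on (\<psi> ` (V \<inter> W)) (\<lambda>y. f (inv_into V \<psi> y))"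
    using f d(1) total.Cinf_iff[OF W] by blast
  moreover have "(\<lambda>(y, t). \<psi> (act (inv_into U \<phi> y) t)) ` ?T \<subseteq> \<psi> ` (V \<inter> W)"
    by (auto simp: action_domain_def)
  ultimately have "Cinf_on ?T (\<lambda>q. f (inv_into V \<psi> (case q of (y, t) \<Rightarrow> \<psi> (act (inv_into U \<phi> y) t))))"
    using Cinf_on_compose[OF T(1) total.chart_image_open_subset[OF d(1) W]] by blast
  then have "Cinf_on ?T (\<lambda>(y, t). f (act (inv_into U \<phi> y) t))"
    by (rule Cinf_on_cong[OF T(1), rotated]) (use d(1) in \<open>auto simp: action_domain_def\<close>)
  then show "\<exists>T. open T \<and> p \<in> T \<and> T \<subseteq> action_domain U \<phi> W \<and>
      Cinf_on T (\<lambda>(y, t). f (act (inv_into U \<phi> y) t))"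
    using T by blast
qed

lemma orbit_smooth:
  assumes m: "m \<in> pts M" and "open I"
  shows "smooth_map_on eucl M I (act m)"
  unfolding smooth_map_on_def
proof (intro conjI)
  have "continuous_map euclideanreal (prod_topology (mtop M) euclideanreal) (\<lambda>t. (m, t))"
    using m by (auto simp: continuous_map_pairwise o_def)
  from continuous_map_compose[OF this action_continuous]
  show "continuous_map (subtopology (mtop eucl) I) (mtop M) (act m)"
    by (auto simp: eucl_def o_def intro: continuous_map_from_subtopology)
  have "Cinf_on {t \<in> I. act m t \<in> V} (\<lambda>t. \<psi> (act m t))" if d: "(V, \<psi>) \<in> atlas M" for V \<psi>
  proof -
    obtain U \<phi> where c: "(U, \<phi>) \<in> atlas M" "m \<in> U" using total.chart_at[OF m] .
    let ?c = "\<lambda>t. (\<phi> m, 0) + (0, t :: real)"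
    let ?O = "action_domain U \<phi> V"
    have O: "open ?O" using action_domain_open[OF c(1) total.chart_open[OF d]] .
    have eq: "{t \<in> I. act m t \<in> V} = I \<inter> ?c -` ?O"
      using c by (auto simp: action_domain_def)
    have T: "open (I \<inter> ?c -` ?O)"
      using \<open>open I\<close> by (intro open_Int open_vimage[OF O] continuous_intros)
    have "Cinf_on (I \<inter> ?c -` ?O) ?c"
      by (rule Cinf_on_affine[OF T]) (intro bounded_linear_Pair bounded_linear_zero bounded_linear_ident)
    from Cinf_on_compose[OF T O _ this action_chart_smooth[OF c(1) d]]
    have "Cinf_on (I \<inter> ?c -` ?O) (\<lambda>t. case ?c t of (y, t) \<Rightarrow> \<psi> (act (inv_into U \<phi> y) t))"
      by blast
    then show ?thesis unfolding eq using c by simp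
  qed
  then show "\<forall>(U, \<phi>)\<in>atlas eucl. \<forall>(V, \<psi>)\<in>atlas M.
      Cinf_on (\<phi> ` {t \<in> U \<inter> I. act m t \<in> V}) (\<psi> \<circ> act m \<circ> inv_into U \<phi>)"
    by (auto simp: eucl_def o_def)
qed

text \<open>
  In a chart, \<open>\<kappa> f\<close> is the partial derivative at \<open>t = 0\<close> of the smooth function \<open>(y, t) \<mapsto> f(act (\<phi>\<^sup>-\<^sup>1 y) t)\<close>,
  that is, its directional derivative along \<open>(0, 1)\<close> composed with \<open>y \<mapsto> (y, 0)\<close>.
\<close>

lemma carroll_field_smooth: "carroll_field M act \<in> Vect M (pts M)"
  unfolding Vect_def
proof (intro CollectI conjI allI ballI impI)
  fix m assume m: "m \<in> pts M"
  have "smooth_map_on eucl M {-1<..<1} (act m)" using orbit_smooth[OF m] by simp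
  then show "carroll_field M act m \<in> tangent_space M m"
    unfolding tangent_space_def carroll_field_def using m action_zero[OF m]
    by (auto intro!: exI[of _ "act m"] exI[of _ 1])
next
  fix W f assume W': "openin (mtop M) W \<and> W \<subseteq> pts M" and f: "f \<in> Cinf M W"
  then have W: "openin (mtop M) W" by simp
  show "(\<lambda>m. carroll_field M act m f) \<in> Cinf M W"
    unfolding total.Cinf_iff[OF W]
  proof clarify
    fix U \<phi> assume c: "(U, \<phi>) \<in> atlas M"
    let ?O = "action_domain U \<phi> W"
    let ?F = "\<lambda>(y, t). f (act (inv_into U \<phi> y) t)"
    let ?S = "\<phi> ` (U \<inter> W)"
    let ?h = "\<lambda>y. (0, 0 :: real) + (y, 0)"
    have O: "open ?O" using action_domain_open[OF c W] .
    have S: "open ?S" using total.chart_image_open_subset[OF c W] .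
    have F: "Cinf_on ?O ?F" using Cinf_along_action[OF c W f] .
    have hS: "?h ` ?S \<subseteq> ?O"
      using c W' action_zero by (auto simp: action_domain_def)
    have "Cinf_on ?S ?h"
      by (rule Cinf_on_affine[OF S]) (intro bounded_linear_Pair bounded_linear_zero bounded_linear_ident)
    from Cinf_on_compose[OF S O hS this Cinf_on_directional[OF F]]
    have "Cinf_on ?S (\<lambda>y. frechet_derivative ?F (at (?h y)) (0, 1))" .
    then show "Cinf_on ?S (\<lambda>y. carroll_field M act (inv_into U \<phi> y) f)"
    proof (rule Cinf_on_cong[OF S, rotated])
      fix y assume y: "y \<in> ?S"
      define m where "m = inv_into U \<phi> y"
      have m: "m \<in> W" "m \<in> pts M" using y c W' by (auto simp: m_def)
      have near: "smooth_near M (act m 0) f"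
        using W f m action_zero by (auto simp: smooth_near_def)
      let ?F' = "frechet_derivative ?F (at (?h y))"
      have dF: "(?F has_derivative ?F') (at (y, 0))"
        using Cinf_on_has_derivative[OF O F subsetD[OF hS imageI[OF y]]] by simp
      have "((\<lambda>t. (y, t)) has_derivative (\<lambda>t. (0, t))) (at (0 :: real))"
        by (auto intro!: derivative_eq_intros)
      from has_derivative_compose[OF this dF]
      have "((\<lambda>t. f (act m t)) has_derivative (\<lambda>t. ?F' (0, t))) (at 0)"
        by (simp add: m_def)
      also have "(\<lambda>t. ?F' (0, t)) = (*) (?F' (0, 1))"
      proof
        fix t :: real
        have "?F' (0, t) = ?F' (t *\<^sub>R (0, 1))" by simp
        also have "\<dots> = ?F' (0, 1) * t"
          by (simp only: linear_scale[OF has_derivative_linear[OF dF]] real_scaleR_def mult.commute)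
        finally show "?F' (0, t) = ?F' (0, 1) * t" .
      qed
      finally have "((f \<circ> act m) has_field_derivative ?F' (0, 1)) (at 0)"
        by (simp add: has_field_derivative_def o_def)
      then show "?F' (0, 1) = carroll_field M act (inv_into U \<phi> y) f"
        using m near by (simp add: carroll_field_def velocity_def DERIV_imp_deriv flip: m_def)
    qed
  qed
qed (simp add: carroll_field_def)

lemma action_preserves_fibres:
  assumes m: "m \<in> pts M"
  shows "\<pi> (act m t) = \<pi> m"
proof -
  have "\<pi> m \<in> pts S"
    using projection_smooth m by (auto simp: smooth_map_on_def continuous_map_def)
  from locally_trivial[OF this] obtain U \<Phi> where U: "\<pi> m \<in> U" "bij_betw \<Phi> (U \<times> UNIV) {m \<in> pts M. \<pi> m \<in> U}"
    "\<forall>y\<in>U. \<forall>s t. \<pi> (\<Phi> (y, s)) = y \<and> act (\<Phi> (y, s)) t = \<Phi> (y, s + t)"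
    by (elim exE conjE)
  have "m \<in> \<Phi> ` (U \<times> UNIV)" using U(1,2) m by (simp add: bij_betw_def)
  then obtain y s where "y \<in> U" "m = \<Phi> (y, s)" by auto
  then show ?thesis using U(3) by auto
qed

lemma carroll_field_vertical: "carroll_field M act \<in> Vect_V M S \<pi>"
proof -
  have "tangent_map M S \<pi> m (carroll_field M act m) = (\<lambda>f. 0)" if m: "m \<in> pts M" for m
  proof
    fix f :: "'s \<Rightarrow> real"
    have "(f \<circ> \<pi>) \<circ> act m = (\<lambda>t. f (\<pi> m))"
      using action_preserves_fibres[OF m] by auto
    then show "tangent_map M S \<pi> m (carroll_field M act m) f = 0"
      using m by (simp add: tangent_map_def carroll_field_def velocity_def)
  qed
  then show ?thesis
    using carroll_field_smooth by (auto simp: Vect_V_def vertical_space_def Vect_def)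
qed

end

section \<open>Bivectors at a point\<close>

lemma ext2_antisym:
  assumes "B \<in> ext2 M m V"
  shows "B \<alpha> \<beta> = - B \<beta> \<alpha>"
  using assms by (auto simp: ext2_def wedge_def simp flip: sum_negf intro!: sum.cong)

context euclidean_manifold
begin

lemma ext2_contraction:
  assumes m: "m \<in> pts M" and B: "B \<in> ext2 M m (tangent_space M m)"
    and \<alpha>: "\<alpha> \<in> cotangent_space M m"
  shows "\<exists>v\<in>tangent_space M m. \<forall>\<beta>\<in>cotangent_space M m. \<beta> v = B \<alpha> \<beta>"
proof -
  obtain n v w where Beq: "B = (\<lambda>\<alpha> \<beta>. \<Sum>i<n::nat. wedge M m (v i) (w i) \<alpha> \<beta>)"
    and vw: "\<And>i. i < n \<Longrightarrow> v i \<in> tangent_space M m" "\<And>i. i < n \<Longrightarrow> w i \<in> tangent_space M m"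
    using B unfolding ext2_def by blast
  define z where "z i = (\<lambda>f. \<alpha> (v i) * w i f + (- \<alpha> (w i)) * v i f)" for i
  have z: "z i \<in> tangent_space M m" if "i < n" for i
    unfolding z_def using vw that by (intro tangent_lincomb)
  have "\<beta> (\<lambda>f. \<Sum>i<n. z i f) = B \<alpha> \<beta>" if \<beta>: "\<beta> \<in> cotangent_space M m" for \<beta>
  proof -
    have "\<beta> (\<lambda>f. \<Sum>i<n. z i f) = (\<Sum>i<n. \<beta> (z i))"
      using z by (intro covector_sum[OF m \<beta>]) simp
    also have "\<dots> = (\<Sum>i<n. wedge M m (v i) (w i) \<alpha> \<beta>)"
    proof (rule sum.cong[OF refl])
      fix i assume "i \<in> {..<n}"
      then show "\<beta> (z i) = wedge M m (v i) (w i) \<alpha> \<beta>"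
        unfolding z_def using covector_lincomb[OF \<beta> vw(2,1), of i i "\<alpha> (v i)" "- \<alpha> (w i)"] \<alpha> \<beta>
        by (simp add: wedge_def)
    qed
    finally show ?thesis by (simp add: Beq)
  qed
  moreover have "(\<lambda>f. \<Sum>i<n. z i f) \<in> tangent_space M m"
    using z by (intro tangent_sum[OF m]) simp
  ultimately show ?thesis by blast
qed

lemma sharp_at_eqI:
  assumes "v \<in> tangent_space M m" "\<And>\<beta>. \<beta> \<in> cotangent_space M m \<Longrightarrow> \<beta> v = P m \<alpha> \<beta>"
  shows "sharp_at M P m \<alpha> = v"
  unfolding sharp_at_def
proof (rule the_equality)
  fix v' assume v': "v' \<in> tangent_space M m \<and> (\<forall>\<beta>\<in>cotangent_space M m. \<beta> v' = P m \<alpha> \<beta>)"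
  show "v' = v" by (rule covectors_separate[of v' m v]) (use v' assms in auto)
qed (use assms in blast)

text \<open>
  The contraction of \<open>\<Sum>i. v_i \<and> w_i\<close> with \<open>\<alpha>\<close> is the vector \<open>\<Sum>i. \<alpha>(v_i) w_i - \<alpha>(w_i) v_i\<close>, and covectors separate
  vectors; so the description of the anchor in its definition determines exactly one vector.
\<close>

lemma sharp_at:
  assumes "m \<in> pts M" "P m \<in> ext2 M m (tangent_space M m)" "\<alpha> \<in> cotangent_space M m"
  shows "sharp_at M P m \<alpha> \<in> tangent_space M m"
    and "\<beta> \<in> cotangent_space M m \<Longrightarrow> \<beta> (sharp_at M P m \<alpha>) = P m \<alpha> \<beta>"
proof -
  obtain v where v: "v \<in> tangent_space M m" "\<And>\<beta>. \<beta> \<in> cotangent_space M m \<Longrightarrow> \<beta> v = P m \<alpha> \<beta>"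
    using ext2_contraction[OF assms] by blast
  have "sharp_at M P m \<alpha> = v" using sharp_at_eqI[of v m P \<alpha>] v by blast
  then show "sharp_at M P m \<alpha> \<in> tangent_space M m"
    "\<beta> \<in> cotangent_space M m \<Longrightarrow> \<beta> (sharp_at M P m \<alpha>) = P m \<alpha> \<beta>"
    using v by simp_all
qed

lemma horizontal_contraction:
  assumes "H \<in> ext2 M m (horizontal_space M \<tau> m)"
  shows "H (\<tau> m) \<beta> = 0"
  using assms by (auto simp: ext2_def horizontal_space_def wedge_def intro!: sum.neutral)

text \<open>
  Write \<open>h(u) = u - \<tau>(u) k\<close> for the horizontal projection. If \<open>B = \<Sum>i. v_i \<and> w_i\<close>, substituting \<open>v_i = h(v_i) + \<tau>(v_i) k\<close>
  and likewise for \<open>w_i\<close> gives \<open>B = k \<and> e + \<Sum>i. h(v_i) \<and> h(w_i)\<close> with \<open>e = \<Sum>i. \<tau>(v_i) w_i - \<tau>(w_i) v_i\<close>, the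
  contraction of \<open>B\<close> with \<open>\<tau>\<close>; the terms quadratic in \<open>\<tau>\<close> cancel by antisymmetry.
\<close>

lemma horizontal_part:
  assumes m: "m \<in> pts M" and B: "B \<in> ext2 M m (tangent_space M m)"
    and \<tau>: "\<tau> m \<in> cotangent_space M m" and k: "k \<in> tangent_space M m" "\<tau> m k = 1"
    and e: "\<And>\<beta>. \<beta> \<in> cotangent_space M m \<Longrightarrow> \<beta> e = B (\<tau> m) \<beta>"
  shows "(\<lambda>\<alpha> \<beta>. B \<alpha> \<beta> - wedge M m k e \<alpha> \<beta>) \<in> ext2 M m (horizontal_space M \<tau> m)"
proof -
  obtain n v w where Beq: "B = (\<lambda>\<alpha> \<beta>. \<Sum>i<n::nat. wedge M m (v i) (w i) \<alpha> \<beta>)"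
    and vw: "\<And>i. i < n \<Longrightarrow> v i \<in> tangent_space M m" "\<And>i. i < n \<Longrightarrow> w i \<in> tangent_space M m"
    using B unfolding ext2_def by blast
  define h where "h u = (\<lambda>f. 1 * u f + (- \<tau> m u) * k f)" for u
  have \<alpha>h: "\<alpha> (h u) = \<alpha> u - \<tau> m u * \<alpha> k"
    if "\<alpha> \<in> cotangent_space M m" "u \<in> tangent_space M m" for \<alpha> u
    unfolding h_def using covector_lincomb[OF that k(1), of 1 "- \<tau> m u"] by simp
  have hor: "h u \<in> horizontal_space M \<tau> m" if "u \<in> tangent_space M m" for u
    using \<alpha>h[OF \<tau> that] k(2) tangent_lincomb[OF that k(1), of 1 "- \<tau> m u"]
    by (simp add: horizontal_space_def h_def)
  have "B \<alpha> \<beta> - wedge M m k e \<alpha> \<beta> = (\<Sum>i<n. wedge M m (h (v i)) (h (w i)) \<alpha> \<beta>)" for \<alpha> \<beta>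
  proof (cases "\<alpha> \<in> cotangent_space M m \<and> \<beta> \<in> cotangent_space M m")
    case True
    have e': "\<gamma> e = (\<Sum>i<n. \<tau> m (v i) * \<gamma> (w i) - \<tau> m (w i) * \<gamma> (v i))"
      if "\<gamma> \<in> cotangent_space M m" for \<gamma>
      using e[OF that] that \<tau> by (simp add: Beq wedge_def)
    have "B \<alpha> \<beta> - wedge M m k e \<alpha> \<beta> =
      (\<Sum>i<n. \<alpha> (v i) * \<beta> (w i) - \<alpha> (w i) * \<beta> (v i)
        - (\<alpha> k * (\<tau> m (v i) * \<beta> (w i) - \<tau> m (w i) * \<beta> (v i))
         - (\<tau> m (v i) * \<alpha> (w i) - \<tau> m (w i) * \<alpha> (v i)) * \<beta> k))"
      using True
      by (simp add: e' Beq wedge_def sum_subtractf sum_distrib_left sum_distrib_right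
          right_diff_distrib left_diff_distrib)
    also have "\<dots> = (\<Sum>i<n. wedge M m (h (v i)) (h (w i)) \<alpha> \<beta>)"
      using True by (intro sum.cong) (auto simp: wedge_def \<alpha>h vw algebra_simps)
    finally show ?thesis .
  qed (auto simp: Beq wedge_def)
  then have "(\<lambda>\<alpha> \<beta>. B \<alpha> \<beta> - wedge M m k e \<alpha> \<beta>) =
      (\<lambda>\<alpha> \<beta>. \<Sum>i<n. wedge M m ((\<lambda>i. h (v i)) i) ((\<lambda>i. h (w i)) i) \<alpha> \<beta>)"
    by (intro ext) simp
  moreover have "\<forall>i<n. h (v i) \<in> horizontal_space M \<tau> m \<and> h (w i) \<in> horizontal_space M \<tau> m"
    using hor vw by blast
  ultimately show ?thesis
    unfolding ext2_def mem_Collect_eq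
    by (intro exI[of _ n] exI[of _ "\<lambda>i. h (v i)"] exI[of _ "\<lambda>i. h (w i)"] conjI)
qed

end

section \<open>The decomposition of the Poisson bivector\<close>

locale euclidean_carrollian_poisson_bundle = carrollian_poisson_bundle M S \<pi> act g \<tau> P
  for M :: "('m, 'e::euclidean_space) mfd" and S :: "('s, 'f::real_normed_vector) mfd"
    and \<pi> :: "'m \<Rightarrow> 's" and act :: "'m \<Rightarrow> real \<Rightarrow> 'm"
    and g :: "'m \<Rightarrow> 'm tvec \<Rightarrow> 'm tvec \<Rightarrow> real" and \<tau> :: "'m \<Rightarrow> 'm covec"
    and P :: "'m \<Rightarrow> 'm bivec"

sublocale euclidean_carrollian_poisson_bundle \<subseteq> euclidean_R_bundle M S \<pi> act
  by unfold_locales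

context euclidean_carrollian_poisson_bundle
begin

abbreviation \<kappa> :: "'m \<Rightarrow> 'm tvec" where
  "\<kappa> \<equiv> carroll_field M act"

definition E_H :: "'m \<Rightarrow> 'm tvec" where
  "E_H = sharp M P \<tau>"

definition P_H :: "'m \<Rightarrow> 'm bivec" where
  "P_H = (\<lambda>m \<alpha> \<beta>. P m \<alpha> \<beta> - wedge M m (\<kappa> m) (E_H m) \<alpha> \<beta>)"

lemma \<kappa>_tangent: "m \<in> pts M \<Longrightarrow> \<kappa> m \<in> tangent_space M m"
  using carroll_field_smooth by (simp add: Vect_def)

lemma clock_covector: "m \<in> pts M \<Longrightarrow> \<tau> m \<in> cotangent_space M m"
  using clock_form by (simp add: Omega1_def)

lemma P_ext2: "m \<in> pts M \<Longrightarrow> P m \<in> ext2 M m (tangent_space M m)"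
  using poisson by (simp add: poisson_structure_def bivector_fields_def bivector_fields_in_def)

lemma P_off: "m \<notin> pts M \<Longrightarrow> P m = (\<lambda>\<alpha> \<beta>. 0)"
  using poisson by (simp add: poisson_structure_def bivector_fields_def bivector_fields_in_def)

lemma P_smooth:
  "openin (mtop M) U \<Longrightarrow> \<alpha> \<in> Omega1 M U \<Longrightarrow> \<beta> \<in> Omega1 M U \<Longrightarrow>
    (\<lambda>m. P m (\<alpha> m) (\<beta> m)) \<in> Cinf M U"
  using poisson by (simp add: poisson_structure_def bivector_fields_def bivector_fields_in_def)

lemma E_H_tangent: "m \<in> pts M \<Longrightarrow> E_H m \<in> tangent_space M m"
  using sharp_at(1)[of m P] P_ext2 clock_covector by (simp add: E_H_def sharp_def)

lemma pairing_E_H: "m \<in> pts M \<Longrightarrow> \<beta> \<in> cotangent_space M m \<Longrightarrow> \<beta> (E_H m) = P m (\<tau> m) \<beta>"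
  using sharp_at(2)[of m P] P_ext2 clock_covector by (simp add: E_H_def sharp_def)

lemma E_H_horizontal: 
  assumes m: "m \<in> pts M"
  shows "\<tau> m (E_H m) = 0"
  using pairing_E_H[OF m clock_covector[OF m]] ext2_antisym[OF P_ext2[OF m], of "\<tau> m" "\<tau> m"] by simp

text \<open>
  For a local function \<open>f\<close>, the derivative of \<open>f\<close> along \<open>P#(\<tau>)\<close> is \<open>P(\<tau>, df)\<close>.
\<close>

lemma E_H_smooth: "E_H \<in> Vect_H M \<tau>"
proof -
  have "(\<lambda>m. E_H m f) \<in> Cinf M U" if U: "openin (mtop M) U" and f: "f \<in> Cinf M U" for U f
  proof (rule total.Cinf_cong[OF U])
    have sub: "U \<subseteq> pts M" using U by (rule openin_subset)
    show "(\<lambda>m. P m (restrict_field U \<tau> m) (restrict_field U (differential_at M f) m)) \<in> Cinf M U"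
      using P_smooth[OF U Omega1_restrict[OF U sub clock_form] differential_smooth[OF U f]] .
    fix m assume m: "m \<in> U"
    then have "m \<in> pts M" using sub by blast
    then show "P m (restrict_field U \<tau> m) (restrict_field U (differential_at M f) m) = E_H m f"
      using m pairing_E_H[OF _ differential_cotangent, of m f] E_H_tangent[of m]
      by (simp add: differential_at_def)
  qed
  then have "E_H \<in> Vect M (pts M)"
    using E_H_tangent by (auto simp: Vect_def E_H_def sharp_def)
  then show ?thesis
    using E_H_tangent E_H_horizontal by (simp add: Vect_H_def horizontal_space_def)
qed

lemma P_H_smooth: "P_H \<in> bivector_fields_H M \<tau>"
  unfolding bivector_fields_H_def bivector_fields_in_def
proof (intro CollectI conjI ballI allI impI)
  fix m assume m: "m \<in> pts M"
  show "P_H m \<in> ext2 M m (horizontal_space M \<tau> m)"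
    unfolding P_H_def
    using m P_ext2 clock_covector \<kappa>_tangent clock_normalised pairing_E_H
    by (intro horizontal_part) auto
next
  fix m assume "m \<notin> pts M"
  then show "P_H m = (\<lambda>\<alpha> \<beta>. 0)"
    by (simp add: P_H_def P_off wedge_def carroll_field_def E_H_def sharp_def fun_eq_iff)
next
  fix U \<alpha> \<beta>
  assume U: "openin (mtop M) U" and \<alpha>: "\<alpha> \<in> Omega1 M U" and \<beta>: "\<beta> \<in> Omega1 M U"
  have sub: "U \<subseteq> pts M" using U by (rule openin_subset)
  have E: "E_H \<in> Vect M (pts M)" using E_H_smooth by (simp add: Vect_H_def)
  note pair = pairing_smooth[OF U subset_refl sub]
  have "(\<lambda>m. P m (\<alpha> m) (\<beta> m) -
      (\<alpha> m (\<kappa> m) * \<beta> m (E_H m) - \<alpha> m (E_H m) * \<beta> m (\<kappa> m))) \<in> Cinf M U"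
    using P_smooth[OF U \<alpha> \<beta>] pair[OF \<alpha>] pair[OF \<beta>] E carroll_field_smooth
    by (intro total.Cinf_diff total.Cinf_mult U) auto
  then show "(\<lambda>m. P_H m (\<alpha> m) (\<beta> m)) \<in> Cinf M U"
    by (rule total.Cinf_cong[OF U]) (use \<alpha> \<beta> in \<open>simp add: P_H_def wedge_def Omega1_def\<close>)
qed

text \<open>
  Both \<open>X\<close> and \<open>\<kappa>\<close> lie in the kernel of \<open>g\<close>, the latter because it is vertical. So does the smooth field
  \<open>Y = X - \<tau>(X) \<kappa>\<close>, which is horizontal; as \<open>g\<close> is positive on horizontal vectors, \<open>g(Y, Y) = 0\<close> forces \<open>Y = 0\<close>.
  The kernel of \<open>g\<close> is only given on globally defined fields, which is why the argument uses the field \<open>Y\<close> and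
  not merely its value at \<open>m\<close>.
\<close>

lemma metric_kernel_spanned:
  assumes X: "X \<in> metric_kernel M g" and m: "m \<in> pts M"
  shows "X m = (\<lambda>f. \<tau> m (X m) * \<kappa> m f)"
proof -
  have XV: "X \<in> Vect M (pts M)" using X by (simp add: metric_kernel_def)
  have \<kappa>: "\<kappa> \<in> metric_kernel M g" using carroll_field_vertical kernel_metric by simp
  define Y where "Y = (\<lambda>m f. X m f - \<tau> m (X m) * \<kappa> m f)"
  have Y: "Y \<in> Vect M (pts M)"
    unfolding Y_def
    using Vect_minus_scaled[OF XV carroll_field_smooth pairing_smooth[OF _ _ _ clock_form XV]] by simp
  have split: "\<alpha> (Y m) = \<alpha> (X m) - \<tau> m (X m) * \<alpha> (\<kappa> m)" if "\<alpha> \<in> cotangent_space M m" for \<alpha>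
    using covector_lincomb[OF that, of "X m" "\<kappa> m" 1 "- \<tau> m (X m)"] XV m \<kappa>_tangent[OF m]
    by (simp add: Y_def Vect_def)
  have Yt: "Y m \<in> tangent_space M m" using Y m by (simp add: Vect_def)
  then have "Y m \<in> horizontal_space M \<tau> m"
    using split[OF clock_covector[OF m]] clock_normalised[OF m] by (simp add: horizontal_space_def)
  moreover have "g m (Y m) (Y m) = g m (X m) (Y m) - \<tau> m (X m) * g m (\<kappa> m) (Y m)"
    using split[of "g m (Y m)"] metric by (simp add: sym2_tensors_def)
  then have "g m (Y m) (Y m) = 0"
    using X \<kappa> Y m by (simp add: metric_kernel_def)
  ultimately have "Y m = (\<lambda>f. 0)" using metric_positive[OF m] by fastforce
  then show ?thesis by (auto simp: Y_def fun_eq_iff)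
qed

text \<open>
  Since \<open>P#(\<eta>)\<close> is in the kernel of \<open>g\<close>, it equals \<open>c \<kappa>\<close> with \<open>c = \<tau>(P#(\<eta>)) = P(\<eta>, \<tau>) = -\<eta>(E)\<close>. As \<open>\<eta>(\<kappa>) = 0\<close>,
  contracting \<open>\<kappa> \<and> E\<close> with \<open>\<eta>\<close> leaves \<open>-\<eta>(E) \<kappa> = c \<kappa>\<close>, so nothing remains for the horizontal part.
\<close>

lemma P_H_annihilates:
  assumes \<eta>: "\<eta> \<in> carrollian_one_forms M S \<pi> g P"
  shows "sharp M P_H \<eta> = (\<lambda>m f. 0)"
proof -
  have "sharp_at M P_H m (\<eta> m) = (\<lambda>f. 0)" if m: "m \<in> pts M" for m
  proof (rule sharp_at_eqI[of _ m P_H, OF zero_tangent[OF m]])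
    fix \<beta> assume \<beta>: "\<beta> \<in> cotangent_space M m"
    have \<eta>m: "\<eta> m \<in> cotangent_space M m" "\<eta> m (\<kappa> m) = 0"
      using \<eta> m carroll_field_vertical by (auto simp: carrollian_one_forms_def Omega1_H_def Omega1_def)
    note at = sharp_at[OF m, of P, OF P_ext2[OF m] \<eta>m(1)]
    let ?X = "sharp M P \<eta>"
    have X: "?X \<in> metric_kernel M g" using \<eta> by (simp add: carrollian_one_forms_def)
    have X\<gamma>: "\<gamma> (?X m) = P m (\<eta> m) \<gamma>" if "\<gamma> \<in> cotangent_space M m" for \<gamma>
      using at(2)[OF that] m by (simp add: sharp_def)
    have "\<tau> m (?X m) = - \<eta> m (E_H m)"
      using X\<gamma>[OF clock_covector[OF m]] pairing_E_H[OF m \<eta>m(1)]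
        ext2_antisym[OF P_ext2[OF m], of "\<eta> m" "\<tau> m"] by simp
    moreover have "\<beta> (?X m) = \<tau> m (?X m) * \<beta> (\<kappa> m)"
      using covector_lincomb[OF \<beta> \<kappa>_tangent[OF m] \<kappa>_tangent[OF m], of "\<tau> m (?X m)" 0]
      by (subst metric_kernel_spanned[OF X m]) simp
    ultimately show "\<beta> (\<lambda>f. 0) = P_H m (\<eta> m) \<beta>"
      using X\<gamma>[OF \<beta>] \<beta> \<eta>m covector_zero[OF \<beta>] by (simp add: P_H_def wedge_def)
  qed
  then show ?thesis by (auto simp: sharp_def)
qed

text \<open>
  A horizontal bivector is annihilated by \<open>\<tau>\<close>. Contracting any decomposition with \<open>\<tau>\<close> therefore gives
  \<open>P(\<tau>, \<beta>) = \<tau>(\<kappa>) \<beta>(E') - \<tau>(E') \<beta>(\<kappa>) = \<beta>(E')\<close>, hence \<open>E' = P#(\<tau>)\<close>, and then \<open>P'\<close> is what is left of \<open>P\<close>.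
\<close>

lemma decomposition_unique:
  assumes E': "E' \<in> Vect_H M \<tau>" and P': "P' \<in> bivector_fields_H M \<tau>"
    and dec: "P = (\<lambda>m \<alpha> \<beta>. wedge M m (\<kappa> m) (E' m) \<alpha> \<beta> + P' m \<alpha> \<beta>)"
  shows "E' = E_H" and "P' = P_H"
proof -
  have "E' m = E_H m" for m
  proof (cases "m \<in> pts M")
    case m: True
    have t: "E' m \<in> tangent_space M m" "\<tau> m (E' m) = 0"
      using E' m by (auto simp: Vect_H_def horizontal_space_def)
    have hor: "P' m (\<tau> m) \<beta> = 0" for \<beta>
      using P' m by (intro horizontal_contraction[of "P' m" m \<tau>]) (simp add: bivector_fields_H_def bivector_fields_in_def)
    show ?thesis
    proof (rule covectors_separate[OF t(1) E_H_tangent[OF m]])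
      fix \<beta> assume \<beta>: "\<beta> \<in> cotangent_space M m"
      have "\<beta> (E_H m) = wedge M m (\<kappa> m) (E' m) (\<tau> m) \<beta> + P' m (\<tau> m) \<beta>"
        using pairing_E_H[OF m \<beta>] by (subst (asm) dec)
      then show "\<beta> (E' m) = \<beta> (E_H m)"
        using \<beta> clock_covector[OF m] clock_normalised[OF m] t(2) hor by (simp add: wedge_def)
    qed
  next
    case False
    then show ?thesis using E' by (simp add: Vect_H_def Vect_def E_H_def sharp_def)
  qed
  then show "E' = E_H" by blast
  then show "P' = P_H" unfolding P_H_def by (subst dec) simp
qed

end

theorem proposition2p2:
  fixes M :: "('m, 'e::euclidean_space) mfd" and S :: "('s, 'f::real_normed_vector) mfd"
    and \<pi> :: "'m \<Rightarrow> 's" and act :: "'m \<Rightarrow> real \<Rightarrow> 'm"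
    and g :: "'m \<Rightarrow> 'm tvec \<Rightarrow> 'm tvec \<Rightarrow> real" and \<tau> :: "'m \<Rightarrow> 'm covec"
    and P :: "'m \<Rightarrow> 'm bivec"
  assumes "carrollian_poisson_bundle M S \<pi> act g \<tau> P"
  shows "\<exists>E PH.
    (E \<in> Vect_H M \<tau> \<and> PH \<in> bivector_fields_H M \<tau> \<and>
     P = (\<lambda>m \<alpha> \<beta>. wedge M m (carroll_field M act m) (E m) \<alpha> \<beta> + PH m \<alpha> \<beta>)) \<and>
    sharp M P \<tau> = E \<and>
    (\<forall>\<eta>\<in>carrollian_one_forms M S \<pi> g P. sharp M PH \<eta> = (\<lambda>m f. 0)) \<and>
    (\<forall>E' PH'.
      E' \<in> Vect_H M \<tau> \<and> PH' \<in> bivector_fields_H M \<tau> \<and>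
      P = (\<lambda>m \<alpha> \<beta>. wedge M m (carroll_field M act m) (E' m) \<alpha> \<beta> + PH' m \<alpha> \<beta>) \<longrightarrow>
      E' = E \<and> PH' = PH)"
proof -
  interpret carrollian_poisson_bundle M S \<pi> act g \<tau> P by (fact assms)
  interpret euclidean_carrollian_poisson_bundle M S \<pi> act g \<tau> P by unfold_locales
  show ?thesis
  proof (intro exI[of _ E_H] exI[of _ P_H] conjI ballI allI impI)
    show "P = (\<lambda>m \<alpha> \<beta>. wedge M m (\<kappa> m) (E_H m) \<alpha> \<beta> + P_H m \<alpha> \<beta>)"
      by (simp add: P_H_def)
    show "sharp M P \<tau> = E_H" by (simp only: E_H_def)
  qed (use E_H_smooth P_H_smooth P_H_annihilates decomposition_unique in blast)+
qed

end
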